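(* Let $p=p_n\to\infty$ and, for each $n$, let $G_n=(V_n,E_n)$ be a decomposable graph on $V_n=\{1,\dots,p_n\}$ whose vertices are ordered according to a perfect vertex elimination scheme. Suppose under the true measure $\mathbb{P}_{0,G}$ the observations $Y_1,\dots,Y_n$ are i.i.d. $N_{p_n}(0,\bar\Omega_n^{-1})$ with $\bar\Omega_n\in P_{G_n}$, and (Assumption D) there is a constant $k_\sigma\in(0,1]$ independent of $n$ with $k_\sigma\le\lambda_{\min}(\bar\Omega_n)\le\lambda_{\max}(\bar\Omega_n)\le1/k_\sigma$; (Assumption F) $(p_n+|E_n|)\log p_n=o(n)$. Consider the working model $Y_i$ i.i.d. $N_p(0,\Omega^{-1})$, $\Omega\in P_{G_n}$, with the $G$-Wishart prior $W_{G_n}(\delta,\Psi_{3n})$ on $\Omega$, where $\delta>0$ and $\Psi_{3n}$ is positive definite with largest eigenvalue at most $a<\infty$ for all $n$. Then for a sufficiently large constant $M$, $$\Pi_{3n}\Bigl(\|\Omega-\bar\Omega_n\|_F>M\sqrt{\tfrac{(p_n+|E_n|)\log p_n}{n}}\ \Bigm|\ Y_1,\dots,Y_n\Bigr)\to0$$ in $\mathbb{P}_{0,G}$-probability as $n\to\infty$.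
   Context: $\|\cdot\|_F$ is the Frobenius norm and $|E_n|$ the number of edges of $G_n$. An undirected graph $G=(V,E)$ is decomposable if it has no induced subgraph that is a cycle of length $\ge4$. $M_G$ is the set of symmetric $p\times p$ matrices $A$ with $A_{ij}=0$ whenever $i\ne j$ and $(i,j)\notin E$; $P_G$ is the set of positive definite matrices in $M_G$. The $G$-Wishart distribution $W_G(\beta,\Psi)$ has density on $P_G$ (w.r.t. Lebesgue measure on the free entries of $M_G$) proportional to $\det(\Omega)^{\beta/2}\exp(-\operatorname{tr}(\Psi\Omega)/2)$. $\Pi_{3n}(\cdot\mid Y_1,\dots,Y_n)$ is the posterior of $\Omega$. *)

theory Defs
  imports "HOL-Probability.Probability" "HOL-Library.Landau_Symbols" "Jordan_Normal_Form.Char_Poly"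
begin

(* Graphs on the vertex set {0..<p} (0-based version of {1..p}); E is the edge relation. *)
definition simple_graph :: "nat \<Rightarrow> (nat \<Rightarrow> nat \<Rightarrow> bool) \<Rightarrow> bool" where
  "simple_graph p E \<longleftrightarrow> (\<forall>i j. E i j \<longrightarrow> i < p \<and> j < p \<and> i \<noteq> j \<and> E j i)"

definition num_edges :: "nat \<Rightarrow> (nat \<Rightarrow> nat \<Rightarrow> bool) \<Rightarrow> nat" where
  "num_edges p E = card {(i, j). i < j \<and> j < p \<and> E i j}"

definition induced_cycle :: "nat \<Rightarrow> (nat \<Rightarrow> nat \<Rightarrow> bool) \<Rightarrow> nat list \<Rightarrow> bool" where
  "induced_cycle p E vs \<longleftrightarrow> length vs \<ge> 4 \<and> distinct vs \<and> set vs \<subseteq> {..<p} \<and>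
     (\<forall>i < length vs. \<forall>j < length vs.
        E (vs ! i) (vs ! j) \<longleftrightarrow> (j = Suc i mod length vs \<or> i = Suc j mod length vs))"

definition decomposable :: "nat \<Rightarrow> (nat \<Rightarrow> nat \<Rightarrow> bool) \<Rightarrow> bool" where
  "decomposable p E \<longleftrightarrow> \<not> (\<exists>vs. induced_cycle p E vs)"

definition perfect_elim_order :: "nat \<Rightarrow> (nat \<Rightarrow> nat \<Rightarrow> bool) \<Rightarrow> bool" where
  "perfect_elim_order p E \<longleftrightarrow>
     (\<forall>v < p. \<forall>u < p. \<forall>w < p. v < u \<and> v < w \<and> u \<noteq> w \<and> E v u \<and> E v w \<longrightarrow> E u w)"

definition sym_mat :: "real mat \<Rightarrow> bool" where
  "sym_mat A \<longleftrightarrow> A \<in> carrier_mat (dim_row A) (dim_row A) \<and>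
     (\<forall>i < dim_row A. \<forall>j < dim_row A. A $$ (i, j) = A $$ (j, i))"

definition pos_def :: "real mat \<Rightarrow> bool" where
  "pos_def A \<longleftrightarrow> sym_mat A \<and>
     (\<forall>x \<in> carrier_vec (dim_row A). x \<noteq> 0\<^sub>v (dim_row A) \<longrightarrow> x \<bullet> (A *\<^sub>v x) > 0)"

definition M_G :: "nat \<Rightarrow> (nat \<Rightarrow> nat \<Rightarrow> bool) \<Rightarrow> real mat set" where
  "M_G p E = {A. A \<in> carrier_mat p p \<and> sym_mat A \<and>
                  (\<forall>i < p. \<forall>j < p. i \<noteq> j \<and> \<not> E i j \<longrightarrow> A $$ (i, j) = 0)}"

definition P_G :: "nat \<Rightarrow> (nat \<Rightarrow> nat \<Rightarrow> bool) \<Rightarrow> real mat set" where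
  "P_G p E = {A \<in> M_G p E. pos_def A}"

definition frob_norm :: "real mat \<Rightarrow> real" where
  "frob_norm A = sqrt (\<Sum>i < dim_row A. \<Sum>j < dim_col A. (A $$ (i, j))\<^sup>2)"

definition mtrace :: "real mat \<Rightarrow> real" where
  "mtrace A = (\<Sum>i < dim_row A. A $$ (i, i))"

definition free_idx :: "nat \<Rightarrow> (nat \<Rightarrow> nat \<Rightarrow> bool) \<Rightarrow> (nat \<times> nat) set" where
  "free_idx p E = {(i, j). i \<le> j \<and> j < p \<and> (i = j \<or> E i j)}"

definition param_space :: "nat \<Rightarrow> (nat \<Rightarrow> nat \<Rightarrow> bool) \<Rightarrow> (nat \<times> nat \<Rightarrow> real) measure" where
  "param_space p E = PiM (free_idx p E) (\<lambda>_. lborel)"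

definition to_mat :: "nat \<Rightarrow> (nat \<Rightarrow> nat \<Rightarrow> bool) \<Rightarrow> (nat \<times> nat \<Rightarrow> real) \<Rightarrow> real mat" where
  "to_mat p E \<theta> = mat p p (\<lambda>(i, j).
     if (min i j, max i j) \<in> free_idx p E then \<theta> (min i j, max i j) else 0)"

definition gw_unnorm :: "nat \<Rightarrow> (nat \<Rightarrow> nat \<Rightarrow> bool) \<Rightarrow> real \<Rightarrow> real mat \<Rightarrow> (nat \<times> nat \<Rightarrow> real) \<Rightarrow> real" where
  "gw_unnorm p E \<beta> \<Psi> \<theta> =
     (let \<Omega> = to_mat p E \<theta> in
      if \<Omega> \<in> P_G p E then det \<Omega> powr (\<beta> / 2) * exp (- mtrace (\<Psi> * \<Omega>) / 2) else 0)"

definition gw_density :: "nat \<Rightarrow> (nat \<Rightarrow> nat \<Rightarrow> bool) \<Rightarrow> real \<Rightarrow> real mat \<Rightarrow> (nat \<times> nat \<Rightarrow> real) \<Rightarrow> ennreal" where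
  "gw_density p E \<beta> \<Psi> \<theta> =
     ennreal (gw_unnorm p E \<beta> \<Psi> \<theta>) / (\<integral>\<^sup>+ t. ennreal (gw_unnorm p E \<beta> \<Psi> t) \<partial>param_space p E)"

(* density of N_p(0, Omega^{-1}) w.r.t. Lebesgue measure on R^p (vectors as functions on {..<p}) *)
definition gauss_dens :: "nat \<Rightarrow> real mat \<Rightarrow> (nat \<Rightarrow> real) \<Rightarrow> real" where
  "gauss_dens p \<Omega> x = (2 * pi) powr (- real p / 2) * sqrt (det \<Omega>) *
     exp (- (\<Sum>i < p. \<Sum>j < p. x i * \<Omega> $$ (i, j) * x j) / 2)"

definition gauss_vec :: "nat \<Rightarrow> real mat \<Rightarrow> (nat \<Rightarrow> real) measure" where
  "gauss_vec p \<Omega> = density (PiM {..<p} (\<lambda>_. lborel)) (\<lambda>x. ennreal (gauss_dens p \<Omega> x))"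

definition sample_measure :: "nat \<Rightarrow> nat \<Rightarrow> real mat \<Rightarrow> (nat \<Rightarrow> nat \<Rightarrow> real) measure" where
  "sample_measure n p \<Omega> = PiM {..<n} (\<lambda>_. gauss_vec p \<Omega>)"

definition likelihood :: "nat \<Rightarrow> nat \<Rightarrow> real mat \<Rightarrow> (nat \<Rightarrow> nat \<Rightarrow> real) \<Rightarrow> real" where
  "likelihood n p \<Omega> Y = (\<Prod>i < n. gauss_dens p \<Omega> (Y i))"

definition posterior :: "nat \<Rightarrow> nat \<Rightarrow> (nat \<Rightarrow> nat \<Rightarrow> bool) \<Rightarrow> real \<Rightarrow> real mat \<Rightarrow>
    (nat \<Rightarrow> nat \<Rightarrow> real) \<Rightarrow> (nat \<times> nat \<Rightarrow> real) set \<Rightarrow> real" where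
  "posterior n p E \<beta> \<Psi> Y A = enn2real
     ((\<integral>\<^sup>+ \<theta>. indicator A \<theta> * ennreal (likelihood n p (to_mat p E \<theta>) Y) * gw_density p E \<beta> \<Psi> \<theta>
          \<partial>param_space p E) /
      (\<integral>\<^sup>+ \<theta>. ennreal (likelihood n p (to_mat p E \<theta>) Y) * gw_density p E \<beta> \<Psi> \<theta> \<partial>param_space p E))"

end

theory Submission
  imports Defs "Jordan_Normal_Form.Spectral_Radius"
begin

text \<open>
  The posterior density is proportional to
  \<open>det \<Omega> powr ((n + \<delta>) / 2) * exp (- tr ((n S\<^sub>n + \<Psi>) \<Omega>) / 2)\<close> on \<open>P\<^sub>G\<close>, where \<open>S\<^sub>n\<close> is the sample
  covariance matrix. Write \<open>\<Omega> = \<Omega>0 + \<Delta>\<close>, \<open>d = p + |E|\<close> and \<open>\<epsilon>\<^sup>2 = d ln p / n\<close>. Simultaneous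
  diagonalization of \<open>\<Omega>0\<close> and \<open>\<Delta>\<close> shows that \<open>ln det\<close> minus its linearization is at least of order
  \<open>-|\<Delta>|\<^sup>2\<close> near zero and at most of order \<open>-M \<epsilon> |\<Delta>|\<close> outside the ball of radius \<open>M \<epsilon>\<close>. The
  linear term involves only the entries of \<open>S\<^sub>n - \<Omega>0\<^sup>-\<^sup>1\<close> at the free positions; there are at most
  \<open>2 d\<close> of them, each with variance \<open>O(1/n)\<close>, so by Markov's inequality it is at most
  \<open>n \<epsilon> |\<Delta>|\<close> up to a constant, with probability \<open>1 - O(1 / ln p)\<close>. On this event the posterior
  mass outside the ball of radius \<open>M \<epsilon>\<close> is at most \<open>1 / p\<close>, by comparing explicit integrals.
\<close>

section \<open>Diagonalization of real symmetric matrices\<close>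

text \<open>Integrating over \<open>d\<close> coordinates must not cost more than exponents of order
  \<open>n \<epsilon>\<^sup>2\<close>. Outside the ball of radius \<open>M \<epsilon>\<close> the
  log posterior falls at a rate proportional to \<open>M n \<epsilon>\<close> in the Frobenius norm,
  and Cauchy-Schwarz over the free coordinates turns this into Laplace functions of scale of order
  \<open>sqrt d / (M n \<epsilon>)\<close>. The cube that serves the denominator has sides
  \<open>\<epsilon> / sqrt d\<close>. As \<open>n \<epsilon>\<^sup>2 = d ln p\<close> is at least
  \<open>d\<close>, the Laplace scale stays below the side once \<open>M\<close> is large, so the
  two \<open>d\<close>-th powers compare in the right direction and only the exponents remain to be
  weighed. The obstacle is that the curvature of \<open>ln det\<close> dies out for large
  perturbations: no quadratic upper bound holds on all of the cone, and the decay has to be taken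
  linear, with a slope fixed by the radius of the ball. The prior enters by conjugacy alone. It
  shifts \<open>n\<close> to \<open>n + \<delta>\<close> and the scatter matrix by
  \<open>\<Psi>\<close>, and both shifts are at most of the order of the noise in the linear term.
  Hence the threshold for \<open>M\<close> depends on \<open>k\<sigma>\<close>, \<open>a\<close> and
  \<open>\<delta>\<close> only.\<close>

lemma symmetric_real_eigenvalue_exists:
  fixes A :: "real mat"
  assumes A: "A \<in> carrier_mat n n" and sym: "A\<^sup>T = A" and n: "n > 0"
  shows "\<exists>ev. eigenvalue A ev"
proof -
  let ?C = "map_mat complex_of_real A"
  have C: "?C \<in> carrier_mat n n" using A by simp
  obtain l where l: "eigenvalue ?C l"
    using spectrum_non_empty[OF C n] unfolding spectrum_def by auto
  then obtain z where z: "z \<in> carrier_vec n" "z \<noteq> 0\<^sub>v n" "?C *\<^sub>v z = l \<cdot>\<^sub>v z"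
    unfolding eigenvalue_def eigenvector_def using C by auto
  let ?z = "vec_index z"
  have row: "(\<Sum>j<n. of_real (A $$ (i,j)) * ?z j) = l * ?z i" if "i < n" for i
  proof -
    have "vec_index (?C *\<^sub>v z) i = l * ?z i" using z that by simp
    moreover have "vec_index (?C *\<^sub>v z) i = (\<Sum>j<n. of_real (A $$ (i,j)) * ?z j)"
      using that A z(1) by (auto simp: scalar_prod_def row_def lessThan_atLeast0 intro!: sum.cong)
    ultimately show ?thesis by simp
  qed
  have s: "A $$ (i,j) = A $$ (j,i)" if "i<n" "j<n" for i j
    using arg_cong[OF sym, of "\<lambda>M. M $$ (j,i)"] that A by auto
  \<comment> \<open>The Hermitian form of \<open>A\<close> at \<open>z\<close>: real because
    \<open>A\<close> is real and symmetric, and equal to \<open>l\<close> times the squared length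
    of \<open>z\<close>. Hence \<open>l\<close> is real.\<close>
  define q where "q = (\<Sum>i<n. \<Sum>j<n. cnj (?z i) * (of_real (A $$ (i,j)) * ?z j))"
  define N where "N = (\<Sum>i<n. (cmod (?z i))\<^sup>2)"
  have "cnj q = (\<Sum>i<n. \<Sum>j<n. ?z i * (of_real (A $$ (i,j)) * cnj (?z j)))"
    unfolding q_def by simp
  also have "\<dots> = (\<Sum>j<n. \<Sum>i<n. ?z i * (of_real (A $$ (i,j)) * cnj (?z j)))"
    by (rule sum.swap)
  also have "\<dots> = q" unfolding q_def by (intro sum.cong refl) (simp add: s)
  finally have cq: "cnj q = q" .
  have "q = (\<Sum>i<n. cnj (?z i) * (l * ?z i))"
    unfolding q_def sum_distrib_left[symmetric] by (intro sum.cong refl) (simp add: row)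
  also have "\<dots> = l * of_real N"
    unfolding N_def of_real_sum sum_distrib_left
    by (intro sum.cong refl) (simp add: complex_norm_square[simplified] mult.commute mult.left_commute)
  finally have ql: "q = l * of_real N" .
  have "N > 0"
  proof -
    obtain i where i: "i < n" "?z i \<noteq> 0"
    proof (rule ccontr)
      assume "\<not> thesis"
      then have "z = 0\<^sub>v n" using z(1) that by (intro eq_vecI) auto
      with z(2) show False by simp
    qed
    show ?thesis unfolding N_def by (rule sum_pos2[of _ i]) (use i in auto)
  qed
  with cq ql have "cnj l = l" by simp
  then have lr: "l = of_real (Re l)" by (metis complex_is_Real_iff Reals_cnj_iff of_real_Re)
  \<comment> \<open>The eigenvector \<open>z\<close> may be properly complex, so the eigenvalue is
    carried back through the characteristic polynomial, whose coefficients are real.\<close>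
  have "poly (char_poly ?C) l = 0" using l eigenvalue_root_char_poly[OF C] by simp
  then have "of_real (poly (char_poly A) (Re l)) = (0::complex)"
    unfolding of_real_hom.char_poly_hom[OF A] by (subst (asm) lr) simp
  then have "poly (char_poly A) (Re l) = 0" by simp
  then show ?thesis using eigenvalue_root_char_poly[OF A] by auto
qed

text \<open>The reflection in the hyperplane orthogonal to \<open>v - e\<^sub>0\<close>.\<close>

lemma householder:
  fixes v :: "real vec"
  assumes v: "v \<in> carrier_vec n" and unit: "(\<Sum>i<n. (vec_index v i)\<^sup>2) = 1" and n: "n > 0"
  shows "\<exists>H. H \<in> carrier_mat n n \<and> H\<^sup>T = H \<and> H * H = 1\<^sub>m n \<and> col H 0 = v"
proof (cases "vec_index v 0 = 1")
  case True
  have "(\<Sum>i\<in>{..<n} - {0}. (vec_index v i)\<^sup>2) = 0"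
    using unit n True by (subst (asm) sum.remove[of _ 0]) auto
  then have "vec_index v i = 0" if "i < n" "i \<noteq> 0" for i
    using that by (subst (asm) sum_nonneg_eq_0_iff) auto
  then have "v = unit_vec n 0" using v n True by (intro eq_vecI) (auto simp: unit_vec_def)
  then show ?thesis using n by (intro exI[of _ "1\<^sub>m n"]) auto
next
  case False
  \<comment> \<open>With \<open>u = v - e_0\<close> the squared length of \<open>u\<close> is
    \<open>2 * m\<close>, so the usual factor \<open>2 / |u|^2\<close> of a reflection becomes
    \<open>1 / m\<close>. If \<open>vec_index v 0 = 1\<close>, then \<open>v = e_0\<close> and there
    is no hyperplane to reflect in; the identity served in that case.\<close>
  define m where "m = 1 - vec_index v 0"
  define u where "u i = vec_index v i - of_bool (i = 0)" for i
  have m: "m \<noteq> 0" using False by (simp add: m_def)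
  have uu: "(\<Sum>k<n. u k * u k) = 2 * m"
  proof -
    have "(\<Sum>k<n. u k * u k) = (\<Sum>k<n. (vec_index v k)\<^sup>2 + (if k = 0 then 1 - 2 * vec_index v k else 0))"
      by (intro sum.cong refl) (auto simp: u_def power2_eq_square algebra_simps)
    also have "\<dots> = 2 * m" using n by (simp add: sum.distrib unit m_def)
    finally show ?thesis .
  qed
  define H where "H = mat n n (\<lambda>(i,j). of_bool (i = j) - u i * u j / m)"
  have H: "H \<in> carrier_mat n n" by (simp add: H_def)
  have "H * H = 1\<^sub>m n"
  proof (rule eq_matI)
    fix i j assume ij: "i < dim_row (1\<^sub>m n)" "j < dim_col (1\<^sub>m n)"
    have "(H * H) $$ (i,j) = (\<Sum>k<n. (of_bool (i = k) - u i * u k / m) * (of_bool (k = j) - u k * u j / m))"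
      using ij by (simp add: H_def scalar_prod_def lessThan_atLeast0)
    also have "\<dots> = (\<Sum>k<n. (if i = k then of_bool (k = j) - u k * u j / m else 0)
         - (if k = j then u i * u k / m else 0) + (u i * u j / m\<^sup>2) * (u k * u k))"
      using m by (intro sum.cong refl) (auto simp: field_simps power2_eq_square)
    also have "\<dots> = of_bool (i = j) - u i * u j / m - u i * u j / m + (u i * u j / m\<^sup>2) * (2 * m)"
      using ij by (simp only: sum.distrib sum_subtractf sum_distrib_left[symmetric] uu) simp
    also have "\<dots> = of_bool (i = j)" using m by (simp add: field_simps power2_eq_square)
    finally show "(H * H) $$ (i,j) = 1\<^sub>m n $$ (i,j)" using ij by simp
  qed (simp_all add: H_def)
  moreover have "H\<^sup>T = H" by (rule eq_matI) (auto simp: H_def)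
  moreover have "col H 0 = v"
    using v n m by (intro eq_vecI) (auto simp: H_def u_def m_def col_def field_simps)
  ultimately show ?thesis using H by blast
qed

lemma symmetric_real_unit_eigenvector:
  fixes A :: "real mat"
  assumes A: "A \<in> carrier_mat n n" and sym: "A\<^sup>T = A" and n: "n > 0"
  shows "\<exists>v e. v \<in> carrier_vec n \<and> (\<Sum>i<n. (vec_index v i)\<^sup>2) = 1 \<and> A *\<^sub>v v = e \<cdot>\<^sub>v v"
proof -
  obtain e w where w: "w \<in> carrier_vec n" "w \<noteq> 0\<^sub>v n" "A *\<^sub>v w = e \<cdot>\<^sub>v w"
    using symmetric_real_eigenvalue_exists[OF assms] A unfolding eigenvalue_def eigenvector_def by auto
  define N where "N = (\<Sum>i<n. (vec_index w i)\<^sup>2)"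
  obtain i where i: "i < n" "vec_index w i \<noteq> 0"
  proof (rule ccontr)
    assume "\<not> thesis"
    then have "w = 0\<^sub>v n" using w(1) that by (intro eq_vecI) auto
    with w(2) show False by simp
  qed
  have N: "N > 0" unfolding N_def by (rule sum_pos2[of _ i]) (use i in auto)
  define v where "v = (1 / sqrt N) \<cdot>\<^sub>v w"
  have "(\<Sum>i<n. (vec_index v i)\<^sup>2) = (\<Sum>i<n. (vec_index w i)\<^sup>2 / N)"
    using w N by (intro sum.cong refl) (simp add: v_def power_divide)
  also have "\<dots> = 1" using N by (simp add: sum_divide_distrib[symmetric] N_def)
  finally have 1: "(\<Sum>i<n. (vec_index v i)\<^sup>2) = 1" .
  have "A *\<^sub>v v = (1 / sqrt N) \<cdot>\<^sub>v (e \<cdot>\<^sub>v w)"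
    unfolding v_def using A w by (simp add: mult_mat_vec)
  also have "\<dots> = e \<cdot>\<^sub>v v" by (simp add: v_def smult_smult_assoc mult.commute)
  finally show ?thesis using 1 w(1) by (intro exI[of _ v] exI[of _ e]) (simp add: v_def)
qed

text \<open>Deflation. The involution \<open>H\<close> exchanges \<open>e_0\<close> with a unit
  eigenvector of \<open>A\<close>, so \<open>H * A * H\<close> has \<open>e_0\<close> as an
  eigenvector; by symmetry its first row vanishes off the diagonal as well, and the induction
  hypothesis diagonalizes the remaining block.\<close>

theorem symmetric_real_diagonalization:
  fixes A :: "real mat"
  assumes "A \<in> carrier_mat n n" and "A\<^sup>T = A"
  shows "\<exists>Q d. Q \<in> carrier_mat n n \<and> Q\<^sup>T * Q = 1\<^sub>m n \<and> Q\<^sup>T * A * Q = mat_diag n d"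
  using assms
proof (induction n arbitrary: A)
  case 0
  then show ?case by (intro exI[of _ "1\<^sub>m 0"] exI[of _ "\<lambda>_. 0"]) (auto simp: mat_diag_def intro!: eq_matI)
next
  case (Suc n A)
  note A = Suc.prems(1)
  obtain v e where v: "v \<in> carrier_vec (Suc n)" "(\<Sum>i<Suc n. (vec_index v i)\<^sup>2) = 1" "A *\<^sub>v v = e \<cdot>\<^sub>v v"
    using symmetric_real_unit_eigenvector[OF Suc.prems] by auto
  obtain H where H: "H \<in> carrier_mat (Suc n) (Suc n)" "H\<^sup>T = H" "H * H = 1\<^sub>m (Suc n)" "col H 0 = v"
    using householder[OF v(1,2)] by auto
  define B where "B = H * A * H"
  have B: "B \<in> carrier_mat (Suc n) (Suc n)" using A H by (simp add: B_def)
  have BT: "B\<^sup>T = B"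
    unfolding B_def using A H Suc.prems(2)
    by (simp add: transpose_mult[of _ "Suc n" "Suc n" _ "Suc n"] assoc_mult_mat[of _ "Suc n" "Suc n" _ "Suc n" _ "Suc n"])
  have Hv: "H *\<^sub>v v = unit_vec (Suc n) 0"
  proof -
    have "H *\<^sub>v v = col (H * H) 0" unfolding H(4)[symmetric] by (rule col_mult2[OF H(1) H(1), symmetric]) simp
    then show ?thesis using H(3) by simp
  qed
  have "B = H * (A * H)" unfolding B_def by (rule assoc_mult_mat[OF H(1) A H(1)])
  moreover have "col (H * (A * H)) 0 = H *\<^sub>v col (A * H) 0"
    by (rule col_mult2[OF H(1) mult_carrier_mat[OF A H(1)]]) simp
  moreover have "col (A * H) 0 = A *\<^sub>v v"
    unfolding H(4)[symmetric] by (rule col_mult2[OF A H(1)]) simp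
  ultimately have "col B 0 = H *\<^sub>v (A *\<^sub>v v)" by simp
  also have "\<dots> = e \<cdot>\<^sub>v unit_vec (Suc n) 0"
    unfolding v(3) using H v(1) by (simp add: mult_mat_vec Hv)
  finally have colB: "col B 0 = e \<cdot>\<^sub>v unit_vec (Suc n) 0" .
  have B0: "B $$ (i,0) = (if i = 0 then e else 0)" if "i < Suc n" for i
    using arg_cong[OF colB, of "\<lambda>w. vec_index w i"] that B by (simp add: unit_vec_def)
  have B0': "B $$ (0,i) = (if i = 0 then e else 0)" if "i < Suc n" for i
    using arg_cong[OF BT, of "\<lambda>M. M $$ (0,i)"] B0[OF that] that B by (simp)
  have Bsym: "B $$ (i,j) = B $$ (j,i)" if "i < Suc n" "j < Suc n" for i j
    using arg_cong[OF BT, of "\<lambda>M. M $$ (i,j)"] that B by simp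
  define A3 where "A3 = mat n n (\<lambda>(i,j). B $$ (Suc i, Suc j))"
  have A3: "A3 \<in> carrier_mat n n" by (simp add: A3_def)
  have "A3\<^sup>T = A3"
    using Bsym by (intro eq_matI) (auto simp: A3_def)
  from Suc.IH[OF A3 this] obtain Q d where Q: "Q \<in> carrier_mat n n" "Q\<^sup>T * Q = 1\<^sub>m n"
    "Q\<^sup>T * A3 * Q = mat_diag n d" by blast
  have Bblock: "B = four_block_mat (mat 1 1 (\<lambda>_. e)) (0\<^sub>m 1 n) (0\<^sub>m n 1) A3"
    using B B0 B0' by (intro eq_matI) (auto simp: A3_def)
  define R where "R = four_block_mat (1\<^sub>m 1) (0\<^sub>m 1 n) (0\<^sub>m n 1) Q"
  have R: "R \<in> carrier_mat (Suc n) (Suc n)" using Q unfolding R_def carrier_mat_def by simp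
  have RT: "R\<^sup>T = four_block_mat (1\<^sub>m 1) (0\<^sub>m 1 n) (0\<^sub>m n 1) Q\<^sup>T"
    unfolding R_def using Q by (subst transpose_four_block_mat[of _ 1 1 _ n _ n]) auto
  have RR: "R\<^sup>T * R = 1\<^sub>m (Suc n)"
  proof -
    have "R\<^sup>T * R = four_block_mat (1\<^sub>m 1) (0\<^sub>m 1 n) (0\<^sub>m n 1) (1\<^sub>m n)"
      unfolding RT unfolding R_def using Q
      by (subst mult_four_block_mat[of _ 1 1 _ n _ n _ _ 1 _ n]) auto
    also have "\<dots> = 1\<^sub>m (Suc n)" by (intro eq_matI) auto
    finally show ?thesis .
  qed
  have RBR: "R\<^sup>T * B * R = mat_diag (Suc n) (\<lambda>i. case i of 0 \<Rightarrow> e | Suc k \<Rightarrow> d k)"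
  proof -
    have 1: "R\<^sup>T * B = four_block_mat (mat 1 1 (\<lambda>_. e)) (0\<^sub>m 1 n) (0\<^sub>m n 1) (Q\<^sup>T * A3)"
      unfolding RT Bblock using Q A3
      by (subst mult_four_block_mat[of _ 1 1 _ n _ n _ _ 1 _ n]) auto
    have "R\<^sup>T * B * R = four_block_mat (mat 1 1 (\<lambda>_. e)) (0\<^sub>m 1 n) (0\<^sub>m n 1) (Q\<^sup>T * A3 * Q)"
      unfolding 1 unfolding R_def using Q A3
      by (subst mult_four_block_mat[of _ 1 1 _ n _ n _ _ 1 _ n]) auto
    also have "\<dots> = mat_diag (Suc n) (\<lambda>i. case i of 0 \<Rightarrow> e | Suc k \<Rightarrow> d k)"
      unfolding Q(3) by (intro eq_matI) (auto simp: mat_diag_def split: nat.splits)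
    finally show ?thesis .
  qed
  note assoc = assoc_mult_mat[of _ "Suc n" "Suc n" _ "Suc n" _ "Suc n"]
  have HR: "(H * R)\<^sup>T = R\<^sup>T * H"
    using H R by (simp add: transpose_mult[of _ "Suc n" "Suc n"])
  have "(H * R)\<^sup>T * (H * R) = R\<^sup>T * ((H * H) * R)"
    unfolding HR using H(1) R by (simp add: assoc)
  then have 1: "(H * R)\<^sup>T * (H * R) = 1\<^sub>m (Suc n)" unfolding H(3) using R RR by simp
  have "(H * R)\<^sup>T * A * (H * R) = R\<^sup>T * B * R"
    unfolding HR B_def using H(1) R A by (simp add: assoc)
  then show ?case using 1 RBR H(1) R
    by (intro exI[of _ "H * R"] exI[of _ "\<lambda>i. case i of 0 \<Rightarrow> e | Suc k \<Rightarrow> d k"]) auto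
qed

section \<open>Perturbations of a positive definite matrix\<close>

definition frob_sq :: "nat \<Rightarrow> real mat \<Rightarrow> real" where
  "frob_sq n A = (\<Sum>i<n. \<Sum>j<n. (A $$ (i,j))\<^sup>2)"

text \<open>For symmetric arguments this is the trace of the product, so one notation covers the
  trace in the prior, the quadratic forms of the data and the derivative of
  \<open>ln det\<close>.\<close>

definition frob_inner :: "nat \<Rightarrow> real mat \<Rightarrow> real mat \<Rightarrow> real" where
  "frob_inner n A B = (\<Sum>i<n. \<Sum>j<n. A $$ (i,j) * B $$ (i,j))"

lemma frob_sq_nonneg: "frob_sq n A \<ge> 0"
  unfolding frob_sq_def by (intro sum_nonneg) auto

lemma frob_norm_frob_sq: "A \<in> carrier_mat n n \<Longrightarrow> frob_norm A = sqrt (frob_sq n A)"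
  unfolding frob_norm_def frob_sq_def by auto

lemma index_mult_sum:
  fixes A B :: "'a::comm_semiring_0 mat"
  assumes "A \<in> carrier_mat n n" "B \<in> carrier_mat n n" "i < n" "j < n"
  shows "(A * B) $$ (i,j) = (\<Sum>k<n. A $$ (i,k) * B $$ (k,j))"
  using assms by (auto simp: scalar_prod_def lessThan_atLeast0 intro!: sum.cong)

lemma frob_sq_transpose: "A \<in> carrier_mat n n \<Longrightarrow> frob_sq n A\<^sup>T = frob_sq n A"
  unfolding frob_sq_def by (subst sum.swap) (auto intro!: sum.cong)

lemma frob_sq_orthogonal_left:
  assumes Q: "Q \<in> carrier_mat n n" and QQ: "Q\<^sup>T * Q = 1\<^sub>m n" and M: "M \<in> carrier_mat n n"
  shows "frob_sq n (Q * M) = frob_sq n M"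
proof -
  have QQ': "(\<Sum>i<n. Q $$ (i,k) * Q $$ (i,l)) = of_bool (k = l)" if "k < n" "l < n" for k l
    using arg_cong[OF QQ, of "\<lambda>X. X $$ (k,l)"] that Q
    by (simp add: index_mult_sum[of _ n] del: index_mult_mat)
  have "frob_sq n (Q * M) = (\<Sum>i<n. \<Sum>j<n. (\<Sum>k<n. Q $$ (i,k) * M $$ (k,j)) * (\<Sum>l<n. Q $$ (i,l) * M $$ (l,j)))"
    unfolding frob_sq_def using Q M
    by (intro sum.cong refl) (simp add: index_mult_sum[of _ n] power2_eq_square del: index_mult_mat)
  also have "\<dots> = (\<Sum>i<n. \<Sum>j<n. \<Sum>k<n. \<Sum>l<n. (Q $$ (i,k) * Q $$ (i,l)) * (M $$ (k,j) * M $$ (l,j)))"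
    unfolding sum_product by (intro sum.cong refl) (simp add: algebra_simps)
  also have "\<dots> = (\<Sum>j<n. \<Sum>k<n. \<Sum>l<n. \<Sum>i<n. (Q $$ (i,k) * Q $$ (i,l)) * (M $$ (k,j) * M $$ (l,j)))"
    by (subst sum.swap, rule sum.cong[OF refl], subst sum.swap, rule sum.cong[OF refl], rule sum.swap)
  also have "\<dots> = (\<Sum>j<n. \<Sum>k<n. \<Sum>l<n. of_bool (k = l) * (M $$ (k,j) * M $$ (l,j)))"
    unfolding sum_distrib_right[symmetric] by (intro sum.cong refl) (simp add: QQ')
  also have "\<dots> = (\<Sum>j<n. \<Sum>k<n. (M $$ (k,j))\<^sup>2)"
    by (intro sum.cong refl) (simp add: of_bool_def if_distrib[of "\<lambda>x. x * _"] power2_eq_square cong: if_cong)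
  also have "\<dots> = frob_sq n M" unfolding frob_sq_def by (rule sum.swap)
  finally show ?thesis .
qed

lemma frob_sq_orthogonal_right:
  assumes Q: "Q \<in> carrier_mat n n" and QQ: "Q * Q\<^sup>T = 1\<^sub>m n" and M: "M \<in> carrier_mat n n"
  shows "frob_sq n (M * Q) = frob_sq n M"
proof -
  have "frob_sq n (M * Q) = frob_sq n (Q\<^sup>T * M\<^sup>T)"
    using Q M by (subst frob_sq_transpose[symmetric]) (auto simp: transpose_mult[of _ n n])
  also have "\<dots> = frob_sq n M\<^sup>T" using Q M QQ by (intro frob_sq_orthogonal_left) auto
  also have "\<dots> = frob_sq n M" by (rule frob_sq_transpose[OF M])
  finally show ?thesis .
qed

lemma frob_sq_orthogonal_conj:
  assumes Q: "Q \<in> carrier_mat n n" "Q\<^sup>T * Q = 1\<^sub>m n" "Q * Q\<^sup>T = 1\<^sub>m n" and M: "M \<in> carrier_mat n n"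
  shows "frob_sq n (Q\<^sup>T * M * Q) = frob_sq n M"
proof -
  have "frob_sq n (Q\<^sup>T * M * Q) = frob_sq n (Q\<^sup>T * M)"
    using Q M by (intro frob_sq_orthogonal_right) auto
  also have "\<dots> = frob_sq n M" using Q M by (intro frob_sq_orthogonal_left) auto
  finally show ?thesis .
qed

lemma sym_mat_transpose: "A \<in> carrier_mat n n \<Longrightarrow> sym_mat A \<longleftrightarrow> A\<^sup>T = A"
proof
  assume A: "A \<in> carrier_mat n n" and "sym_mat A"
  then show "A\<^sup>T = A" unfolding sym_mat_def by (intro eq_matI) auto
next
  assume A: "A \<in> carrier_mat n n" and T: "A\<^sup>T = A"
  show "sym_mat A" unfolding sym_mat_def
  proof (intro conjI allI impI)
    fix i j assume "i < dim_row A" "j < dim_row A"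
    then show "A $$ (i,j) = A $$ (j,i)" using arg_cong[OF T, of "\<lambda>M. M $$ (j,i)"] A by simp
  qed (use A in auto)
qed

lemma det_mat_diag: "det (mat_diag n f) = (\<Prod>i<n. f i)"
proof -
  have "upper_triangular (mat_diag n f)" by (auto simp: upper_triangular_def mat_diag_def)
  then have "det (mat_diag n f) = prod_list (diag_mat (mat_diag n f))"
    by (rule det_upper_triangular[OF _ mat_diag_dim])
  also have "\<dots> = (\<Prod>i<n. f i)" unfolding prod_list_diag_prod
    by (intro prod.cong) (auto simp: mat_diag_def)
  finally show ?thesis .
qed

lemma frob_sq_mat_diag: "frob_sq n (mat_diag n f) = (\<Sum>i<n. (f i)\<^sup>2)"
  unfolding frob_sq_def mat_diag_def
  by (intro sum.cong refl) (simp add: if_distrib[of "\<lambda>x. x\<^sup>2"] cong: if_cong)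

text \<open>The last clause identifies the diagonal entries as eigenvalues, which is the form in
  which the spectral hypotheses are given.\<close>

lemma symmetric_orthonormal_eigenbasis:
  fixes A :: "real mat"
  assumes A: "A \<in> carrier_mat n n" and sym: "A\<^sup>T = A"
  obtains Q d where "Q \<in> carrier_mat n n" "Q\<^sup>T * Q = 1\<^sub>m n" "Q * Q\<^sup>T = 1\<^sub>m n"
    "Q\<^sup>T * A * Q = mat_diag n d" "\<And>i. i < n \<Longrightarrow> eigenvalue A (d i)"
proof -
  obtain Q d where Q: "Q \<in> carrier_mat n n" "Q\<^sup>T * Q = 1\<^sub>m n" "Q\<^sup>T * A * Q = mat_diag n d"
    using symmetric_real_diagonalization[OF assms] by blast
  have QQ: "Q * Q\<^sup>T = 1\<^sub>m n" using mat_mult_left_right_inverse[of "Q\<^sup>T" n Q] Q by simp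
  have "Q * (Q\<^sup>T * A * Q) = (Q * Q\<^sup>T) * (A * Q)"
    using Q(1) A by (simp add: assoc_mult_mat[of _ n n _ n _ n])
  then have AQ: "A * Q = Q * mat_diag n d" using Q A QQ by simp
  have "eigenvalue A (d i)" if i: "i < n" for i
  proof -
    have "A *\<^sub>v col Q i = col (A * Q) i" by (rule col_mult2[OF A Q(1) i, symmetric])
    also have "\<dots> = d i \<cdot>\<^sub>v col Q i"
      unfolding AQ mat_diag_mult_right[OF Q(1)] using Q(1) i by (intro eq_vecI) auto
    finally have 1: "A *\<^sub>v col Q i = d i \<cdot>\<^sub>v col Q i" .
    have "col Q i \<bullet> col Q i = 1"
      using arg_cong[OF Q(2), of "\<lambda>M. M $$ (i,i)"] i Q(1) by simp
    then have "col Q i \<noteq> 0\<^sub>v n" using Q(1) by auto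
    then show ?thesis using 1 A Q(1) i unfolding eigenvalue_def eigenvector_def
      by (intro exI[of _ "col Q i"]) auto
  qed
  then show ?thesis using that Q QQ by blast
qed

text \<open>Substituting \<open>x = X *\<^sub>v y\<close> turns the quadratic form of
  \<open>M\<close> into a weighted sum of squares with weights \<open>f i\<close>, and the
  substitution is bijective. \<open>X\<close> is only required to be invertible, since the matrix
  that diagonalizes two forms at once is in general not orthogonal.\<close>

lemma pos_def_congruence:
  fixes M X :: "real mat"
  assumes M: "M \<in> carrier_mat n n" "M\<^sup>T = M" and X: "X \<in> carrier_mat n n"
    and Y: "Y \<in> carrier_mat n n" and XY: "X * Y = 1\<^sub>m n" and D: "X\<^sup>T * M * X = mat_diag n f"
  shows "pos_def M \<longleftrightarrow> (\<forall>i<n. f i > 0)"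
proof -
  have YX: "Y * X = 1\<^sub>m n" using mat_mult_left_right_inverse[OF X Y XY] .
  have quad: "(X *\<^sub>v y) \<bullet> (M *\<^sub>v (X *\<^sub>v y)) = (\<Sum>i<n. f i * (vec_index y i)\<^sup>2)" if y: "y \<in> carrier_vec n" for y
  proof -
    have "(X *\<^sub>v y) \<bullet> (M *\<^sub>v (X *\<^sub>v y)) = (M *\<^sub>v (X *\<^sub>v y)) \<bullet> (X *\<^sub>v y)"
      using M X y by (intro comm_scalar_prod[of _ n]) auto
    also have "\<dots> = (X\<^sup>T *\<^sub>v (M *\<^sub>v (X *\<^sub>v y))) \<bullet> y"
      using M X y by (intro transpose_vec_mult_scalar[symmetric]) auto
    also have "X\<^sup>T *\<^sub>v (M *\<^sub>v (X *\<^sub>v y)) = (X\<^sup>T * M * X) *\<^sub>v y"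
      using M X y by (simp add: assoc_mult_mat_vec[of _ n n _ n])
    also have "\<dots> = mat_diag n f *\<^sub>v y" unfolding D ..
    also have "mat_diag n f *\<^sub>v y = vec n (\<lambda>i. f i * vec_index y i)"
      using y by (intro eq_vecI) (auto simp: mat_diag_def scalar_prod_def row_def if_distrib[of "\<lambda>x. x * _"] cong: if_cong)
    also have "vec n (\<lambda>i. f i * vec_index y i) \<bullet> y = (\<Sum>i<n. f i * (vec_index y i)\<^sup>2)"
      using y by (auto simp: scalar_prod_def lessThan_atLeast0 power2_eq_square intro!: sum.cong)
    finally show ?thesis .
  qed
  show ?thesis
  proof
    assume pd: "pos_def M"
    show "\<forall>i<n. f i > 0"
    proof (intro allI impI)
      fix i assume i: "i < n"
      define x where "x = X *\<^sub>v unit_vec n i"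
      have "Y *\<^sub>v x = unit_vec n i"
        unfolding x_def using X Y YX by (simp add: assoc_mult_mat_vec[of Y n n X n, symmetric])
      moreover have "Y *\<^sub>v 0\<^sub>v n = 0\<^sub>v n" using Y by (intro eq_vecI) auto
      moreover have "unit_vec n i \<noteq> (0\<^sub>v n :: real vec)"
        using i by (metis index_unit_vec(1) index_zero_vec(1) zero_neq_one)
      ultimately have "x \<noteq> 0\<^sub>v n" by auto
      then have "x \<bullet> (M *\<^sub>v x) > 0" using pd M X unfolding pos_def_def x_def by auto
      then have "0 < (\<Sum>j<n. f j * (vec_index (unit_vec n i) j)\<^sup>2)" unfolding x_def by (subst (asm) quad) auto
      also have "\<dots> = f i" using i
        by (simp add: unit_vec_def if_distrib[of "\<lambda>x. x\<^sup>2"] if_distrib[of "\<lambda>x. _ * x"] cong: if_cong)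
      finally show "f i > 0" .
    qed
  next
    assume f: "\<forall>i<n. f i > 0"
    have "x \<bullet> (M *\<^sub>v x) > 0" if x: "x \<in> carrier_vec n" "x \<noteq> 0\<^sub>v n" for x
    proof -
      define y where "y = Y *\<^sub>v x"
      have y: "y \<in> carrier_vec n" using x Y by (simp add: y_def)
      have xy: "x = X *\<^sub>v y" unfolding y_def using X Y XY x by (simp add: assoc_mult_mat_vec[of X n n Y n, symmetric])
      have "y \<noteq> 0\<^sub>v n" using x xy X by auto
      then obtain i where i: "i < n" "vec_index y i \<noteq> 0" using y by (metis carrier_vecD eq_vecI index_zero_vec(1,2))
      have "(\<Sum>i<n. f i * (vec_index y i)\<^sup>2) > 0"
      proof (rule sum_pos2[of _ i])
        show "0 < f i * (vec_index y i)\<^sup>2" using f i by simp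
        show "0 \<le> f j * (vec_index y j)\<^sup>2" if "j \<in> {..<n}" for j using f that by (simp add: less_imp_le)
      qed (use i in auto)
      then show ?thesis unfolding xy quad[OF y] .
    qed
    then show "pos_def M" unfolding pos_def_def using M sym_mat_transpose[OF M(1)] by auto
  qed
qed

text \<open>Cyclicity of the trace. It makes the sum of the diagonal entries a linear functional of
  \<open>M\<close>.\<close>

lemma congruence_trace:
  assumes X: "X \<in> carrier_mat n n" and M: "M \<in> carrier_mat n n"
  shows "(\<Sum>i<n. (X\<^sup>T * M * X) $$ (i,i)) = frob_inner n (X * X\<^sup>T) M"
proof -
  have "(\<Sum>i<n. (X\<^sup>T * M * X) $$ (i,i)) = (\<Sum>i<n. \<Sum>k<n. \<Sum>l<n. X $$ (k,i) * (M $$ (k,l) * X $$ (l,i)))"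
    using X M by (intro sum.cong refl) (simp add: index_mult_sum[of _ n] sum_distrib_left del: index_mult_mat)
  also have "\<dots> = (\<Sum>k<n. \<Sum>l<n. \<Sum>i<n. X $$ (k,i) * (M $$ (k,l) * X $$ (l,i)))"
    by (subst sum.swap, rule sum.cong[OF refl], rule sum.swap)
  also have "\<dots> = frob_inner n (X * X\<^sup>T) M"
    unfolding frob_inner_def using X
    by (intro sum.cong refl) (simp add: index_mult_sum[of _ n] sum_distrib_left mult_ac del: index_mult_mat)
  finally show ?thesis .
qed

text \<open>The interface between the spectral theory and the analysis. \<open>S\<close> is fixed
  before \<open>\<Delta>\<close>, so the linear term of \<open>ln det\<close> is the same functional
  in every direction. The two inequalities between the squares of \<open>\<mu>\<close> and of
  \<open>\<Delta>\<close> carry the eigenvalue bounds of \<open>A\<close>.\<close>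

definition spectral_perturbation :: "nat \<Rightarrow> real \<Rightarrow> real mat \<Rightarrow> real mat \<Rightarrow> bool" where
  "spectral_perturbation n k A S \<longleftrightarrow> S \<in> carrier_mat n n \<and> S\<^sup>T = S \<and> frob_sq n S \<le> real n / k\<^sup>2 \<and> det A > 0 \<and>
    (\<forall>\<Delta>. \<Delta> \<in> carrier_mat n n \<longrightarrow> \<Delta>\<^sup>T = \<Delta> \<longrightarrow> (\<exists>\<mu>.
       det (A + \<Delta>) = det A * (\<Prod>i<n. 1 + \<mu> i) \<and> (\<Sum>i<n. \<mu> i) = frob_inner n S \<Delta> \<and>
       k\<^sup>2 * frob_sq n \<Delta> \<le> (\<Sum>i<n. (\<mu> i)\<^sup>2) \<and> (\<Sum>i<n. (\<mu> i)\<^sup>2) \<le> frob_sq n \<Delta> / k\<^sup>2 \<and>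
       (pos_def (A + \<Delta>) \<longleftrightarrow> (\<forall>i<n. 1 + \<mu> i > 0))))"

text \<open>With \<open>A = W\<^sup>-\<^sup>T W\<^sup>-\<^sup>1\<close>, the numbers \<open>\<mu> i\<close> are the eigenvalues of
  \<open>W\<^sup>T \<Delta> W\<close>, and \<open>S\<close> is the inverse of \<open>A\<close>.\<close>

lemma pos_def_perturbation:
  fixes A :: "real mat"
  assumes A: "A \<in> carrier_mat n n" "A\<^sup>T = A" and k: "0 < k"
    and ev: "\<And>e. eigenvalue A e \<Longrightarrow> k \<le> e \<and> e \<le> 1 / k"
  shows "\<exists>S. spectral_perturbation n k A S"
proof -
  obtain Q d where Q: "Q \<in> carrier_mat n n" "Q\<^sup>T * Q = 1\<^sub>m n" "Q * Q\<^sup>T = 1\<^sub>m n"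
    "Q\<^sup>T * A * Q = mat_diag n d" "\<And>i. i < n \<Longrightarrow> eigenvalue A (d i)"
    using symmetric_orthonormal_eigenbasis[OF A] by blast
  have d: "k \<le> d i" "d i \<le> 1 / k" "0 < d i" if "i < n" for i
    using ev[OF Q(5)[OF that]] k by auto
  note assoc = assoc_mult_mat[of _ n n _ n _ n]
  define R where "R = mat_diag n (\<lambda>i. 1 / sqrt (d i))"
  define R' where "R' = mat_diag n (\<lambda>i. sqrt (d i))"
  have R: "R \<in> carrier_mat n n" "R' \<in> carrier_mat n n" by (simp_all add: R_def R'_def)
  have RT: "R\<^sup>T = R" by (rule eq_matI) (auto simp: R_def mat_diag_def)
  have RR': "R * R' = 1\<^sub>m n"
    unfolding R_def R'_def mat_diag_diag using d by (intro eq_matI) (auto simp: mat_diag_def dest!: d(3))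
  define W where "W = Q * R"
  have W: "W \<in> carrier_mat n n" using Q R by (simp add: W_def)
  have WT: "W\<^sup>T = R * Q\<^sup>T" using Q R RT by (simp add: W_def transpose_mult[of _ n n])
  have Wcong: "W\<^sup>T * M * W = R * (Q\<^sup>T * M * Q) * R" if "M \<in> carrier_mat n n" for M
    unfolding WT unfolding W_def using Q(1) R that by (simp add: assoc)
  have WAW: "W\<^sup>T * A * W = 1\<^sub>m n"
    unfolding Wcong[OF A(1)] Q(4) unfolding R_def mat_diag_diag
    by (intro eq_matI) (auto simp: mat_diag_def real_sqrt_mult_self field_simps dest: d(3))
  define S where "S = W * W\<^sup>T"
  have S: "S \<in> carrier_mat n n" using W by (simp add: S_def)
  have ST: "S\<^sup>T = S" unfolding S_def using W by (simp add: transpose_mult[of _ n n])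
  have S_eq: "S = Q\<^sup>T\<^sup>T * (R * R) * Q\<^sup>T"
    unfolding S_def WT unfolding W_def using Q R by (simp add: assoc)
  have "frob_sq n S = frob_sq n (R * R)"
    unfolding S_eq by (rule frob_sq_orthogonal_conj) (use Q R in auto)
  also have "\<dots> = (\<Sum>i<n. (1 / d i)\<^sup>2)"
    unfolding R_def mat_diag_diag frob_sq_mat_diag
    by (intro sum.cong refl) (simp add: d(3) less_imp_le)
  also have "\<dots> \<le> (\<Sum>i<n. (1 / k)\<^sup>2)"
    using d k by (intro sum_mono power_mono divide_left_mono) (auto intro: less_imp_le)
  also have "\<dots> = real n / k\<^sup>2" by (simp add: power_divide)
  finally have fS: "frob_sq n S \<le> real n / k\<^sup>2" .
  have detW: "(det W)\<^sup>2 * det A = 1"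
    using arg_cong[OF WAW, of det] W A
    by (simp add: det_mult[of _ n] det_transpose[of _ n] power2_eq_square mult_ac)
  then have detA: "det A > 0"
    using mult_nonneg_nonpos[of "(det W)\<^sup>2" "det A"] by (cases "det A > 0") (auto simp: not_less)
  have main: "\<exists>\<mu>. det (A + \<Delta>) = det A * (\<Prod>i<n. 1 + \<mu> i) \<and> (\<Sum>i<n. \<mu> i) = frob_inner n S \<Delta> \<and>
       k\<^sup>2 * frob_sq n \<Delta> \<le> (\<Sum>i<n. (\<mu> i)\<^sup>2) \<and> (\<Sum>i<n. (\<mu> i)\<^sup>2) \<le> frob_sq n \<Delta> / k\<^sup>2 \<and>
       (pos_def (A + \<Delta>) \<longleftrightarrow> (\<forall>i<n. 1 + \<mu> i > 0))"
    if D: "\<Delta> \<in> carrier_mat n n" "\<Delta>\<^sup>T = \<Delta>" for \<Delta>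
  proof -
    define U where "U = W\<^sup>T * \<Delta> * W"
    have U: "U \<in> carrier_mat n n" using W D by (simp add: U_def)
    have UT: "U\<^sup>T = U" unfolding U_def using W D
      by (simp add: transpose_mult[of _ n n _ n] assoc)
    obtain P \<mu> where P: "P \<in> carrier_mat n n" "P\<^sup>T * P = 1\<^sub>m n" "P * P\<^sup>T = 1\<^sub>m n"
      "P\<^sup>T * U * P = mat_diag n \<mu>"
      using symmetric_orthonormal_eigenbasis[OF U UT] by blast
    \<comment> \<open>A further rotation \<open>P\<close> keeps \<open>W\<^sup>T * A * W\<close>
      equal to the identity, so \<open>X\<close> takes \<open>A\<close> to the identity and
      \<open>\<Delta>\<close> to a diagonal matrix simultaneously.\<close>
    define X where "X = W * P"
    have X: "X \<in> carrier_mat n n" using W P by (simp add: X_def)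
    have XT: "X\<^sup>T = P\<^sup>T * W\<^sup>T" unfolding X_def using W P by (simp add: transpose_mult[of _ n n])
    have Xcong: "X\<^sup>T * M * X = P\<^sup>T * (W\<^sup>T * M * W) * P" if "M \<in> carrier_mat n n" for M
      unfolding XT unfolding X_def using W P(1) that by (simp add: assoc)
    have XDX: "X\<^sup>T * \<Delta> * X = mat_diag n \<mu>" using Xcong[OF D(1)] P(4) by (simp add: U_def)
    have XAX: "X\<^sup>T * A * X = 1\<^sub>m n" unfolding Xcong[OF A(1)] WAW using P by simp
    have XMX: "X\<^sup>T * (A + \<Delta>) * X = mat_diag n (\<lambda>i. 1 + \<mu> i)"
    proof -
      have "X\<^sup>T * (A + \<Delta>) * X = X\<^sup>T * A * X + X\<^sup>T * \<Delta> * X"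
        using X A D by (simp add: mult_add_distrib_mat[of _ n n] add_mult_distrib_mat[of _ n n])
      also have "\<dots> = mat_diag n (\<lambda>i. 1 + \<mu> i)"
        unfolding XAX XDX by (intro eq_matI) (auto simp: mat_diag_def)
      finally show ?thesis .
    qed
    \<comment> \<open>\<open>X\<close> depends on \<open>\<Delta>\<close> through \<open>P\<close>,
      but \<open>P\<close> cancels here; this is what makes \<open>S\<close> uniform in
      \<open>\<Delta>\<close>.\<close>
    have XX: "X * X\<^sup>T = S"
    proof -
      have "X * X\<^sup>T = W * (P * P\<^sup>T) * W\<^sup>T"
        unfolding XT unfolding X_def using W P(1) by (simp add: assoc)
      then show ?thesis unfolding P(3) S_def using W by simp
    qed
    have M: "A + \<Delta> \<in> carrier_mat n n" "(A + \<Delta>)\<^sup>T = A + \<Delta>"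
      using A D by (simp_all add: transpose_add[of _ n n])
    have detX: "(det X)\<^sup>2 * det A = 1"
      using arg_cong[OF XAX, of det] X A
      by (simp add: det_mult[of _ n] det_transpose[of _ n] power2_eq_square mult_ac)
    have "(det X)\<^sup>2 * det (A + \<Delta>) = (\<Prod>i<n. 1 + \<mu> i)"
      using arg_cong[OF XMX, of det] X M
      by (simp add: det_mult[of _ n] det_transpose[of _ n] power2_eq_square mult_ac det_mat_diag)
    then have 1: "det (A + \<Delta>) = det A * (\<Prod>i<n. 1 + \<mu> i)"
      using detX by (metis mult.commute mult.left_commute mult_1)
    have "(\<Sum>i<n. \<mu> i) = (\<Sum>i<n. (X\<^sup>T * \<Delta> * X) $$ (i,i))"
      unfolding XDX by (simp add: mat_diag_def)
    then have 2: "(\<Sum>i<n. \<mu> i) = frob_inner n S \<Delta>"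
      using congruence_trace[OF X D(1)] XX by simp
    \<comment> \<open>The normalization \<open>X\<^sup>T * A * X = 1\<^sub>m n\<close> exhibits
      \<open>X\<^sup>T * A\<close> as the inverse that the congruence criterion asks for.\<close>
    have "X * (X\<^sup>T * A) = 1\<^sub>m n"
      by (rule mat_mult_left_right_inverse) (use X A XAX in auto)
    then have 3: "pos_def (A + \<Delta>) \<longleftrightarrow> (\<forall>i<n. 1 + \<mu> i > 0)"
      using X A by (intro pos_def_congruence[OF M X _ _ XMX, of "X\<^sup>T * A"]) auto
    have "(\<Sum>i<n. (\<mu> i)\<^sup>2) = frob_sq n (P\<^sup>T * U * P)" unfolding P(4) frob_sq_mat_diag ..
    also have "\<dots> = frob_sq n U"
      by (rule frob_sq_orthogonal_conj[OF P(1,2,3) U])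
    finally have mU: "(\<Sum>i<n. (\<mu> i)\<^sup>2) = frob_sq n U" .
    \<comment> \<open>\<open>V\<close> is \<open>\<Delta>\<close> in the eigenbasis of
      \<open>A\<close>. There the scaling by \<open>R\<close> acts entrywise, dividing the square of
      entry \<open>(i,j)\<close> by \<open>d i * d j\<close>, so both norm comparisons reduce to
      bounds on that product.\<close>
    define V where "V = Q\<^sup>T * \<Delta> * Q"
    have V: "V \<in> carrier_mat n n" using Q D by (simp add: V_def)
    have fV: "frob_sq n V = frob_sq n \<Delta>"
      unfolding V_def by (rule frob_sq_orthogonal_conj[OF Q(1,2,3) D(1)])
    have Uij: "(U $$ (i,j))\<^sup>2 = (V $$ (i,j))\<^sup>2 / (d i * d j)" if "i < n" "j < n" for i j
    proof -
      have "U = R * V * R" unfolding U_def Wcong[OF D(1)] V_def ..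
      then have "U $$ (i,j) = 1 / sqrt (d i) * V $$ (i,j) * (1 / sqrt (d j))"
        unfolding R_def mat_diag_mult_left[OF V] using that V
        by (subst (asm) mat_diag_mult_right[of _ n]) auto
      then show ?thesis using d that by (simp add: power_divide power_mult_distrib less_imp_le)
    qed
    have dd: "k\<^sup>2 \<le> d i * d j" "d i * d j \<le> 1 / k\<^sup>2" "0 < d i * d j" if "i < n" "j < n" for i j
    proof -
      show "k\<^sup>2 \<le> d i * d j" unfolding power2_eq_square using d that k by (intro mult_mono) (auto intro: less_imp_le)
      have "d i * d j \<le> (1/k) * (1/k)" using d that k by (intro mult_mono) (auto intro: less_imp_le)
      then show "d i * d j \<le> 1 / k\<^sup>2" by (simp add: power2_eq_square)
      show "0 < d i * d j" using d that by simp
    qed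
    have "frob_sq n U \<le> (\<Sum>i<n. \<Sum>j<n. (V $$ (i,j))\<^sup>2 / k\<^sup>2)"
      unfolding frob_sq_def using dd k by (intro sum_mono) (auto simp: Uij intro!: divide_left_mono)
    then have 4: "frob_sq n U \<le> frob_sq n \<Delta> / k\<^sup>2"
      unfolding fV[symmetric] by (simp add: frob_sq_def sum_divide_distrib)
    have "(\<Sum>i<n. \<Sum>j<n. k\<^sup>2 * (V $$ (i,j))\<^sup>2) \<le> frob_sq n U"
      unfolding frob_sq_def
    proof (intro sum_mono)
      fix i j assume ij: "i \<in> {..<n}" "j \<in> {..<n}"
      have "k\<^sup>2 * (d i * d j) \<le> 1" using dd(2)[of i j] ij k by (simp add: field_simps)
      then have "(k\<^sup>2 * (d i * d j)) * (V $$ (i,j))\<^sup>2 \<le> 1 * (V $$ (i,j))\<^sup>2"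
        by (intro mult_right_mono) auto
      then show "k\<^sup>2 * (V $$ (i,j))\<^sup>2 \<le> (U $$ (i,j))\<^sup>2"
        using dd(3)[of i j] ij by (simp add: Uij pos_le_divide_eq mult_ac)
    qed
    then have 5: "k\<^sup>2 * frob_sq n \<Delta> \<le> frob_sq n U"
      unfolding fV[symmetric] by (simp add: frob_sq_def sum_distrib_left)
    show ?thesis using 1 2 3 4 5 mU by (intro exI[of _ \<mu>]) simp
  qed
  show ?thesis unfolding spectral_perturbation_def using S ST fS detA main by (intro exI[of _ S]) auto
qed

text \<open>Positivity is what lets an upper bound on the eigenvalues bound their squares. It is
  applied to the prior scale matrix.\<close>

lemma pos_def_frob_sq_le:
  assumes A: "A \<in> carrier_mat n n" and pd: "pos_def A" and ev: "\<And>e. eigenvalue A e \<Longrightarrow> e \<le> a"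
  shows "frob_sq n A \<le> real n * a\<^sup>2"
proof -
  have AT: "A\<^sup>T = A" using pd sym_mat_transpose[OF A] by (simp add: pos_def_def)
  obtain Q d where Q: "Q \<in> carrier_mat n n" "Q\<^sup>T * Q = 1\<^sub>m n" "Q * Q\<^sup>T = 1\<^sub>m n"
    "Q\<^sup>T * A * Q = mat_diag n d" "\<And>i. i < n \<Longrightarrow> eigenvalue A (d i)"
    using symmetric_orthonormal_eigenbasis[OF A AT] by blast
  have d: "\<forall>i<n. 0 < d i"
    using pos_def_congruence[OF A AT Q(1) _ Q(3,4)] pd Q(1) by auto
  have "frob_sq n A = frob_sq n (Q\<^sup>T * A * Q)"
    by (rule frob_sq_orthogonal_conj[OF Q(1,2,3) A, symmetric])
  also have "\<dots> = (\<Sum>i<n. (d i)\<^sup>2)" unfolding Q(4) frob_sq_mat_diag ..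
  also have "\<dots> \<le> (\<Sum>i<n. a\<^sup>2)"
    using d ev[OF Q(5)] by (intro sum_mono power_mono) (auto intro: less_imp_le)
  finally show ?thesis by simp
qed

section \<open>Gaussian integrals\<close>

lemma measurable_lborel_component:
  assumes "a \<in> I"
  shows "(\<lambda>x. x a) \<in> borel_measurable (PiM I (\<lambda>_. lborel))"
  using measurable_component_singleton[OF assms, of "\<lambda>_. lborel"]
  by (simp add: measurable_cong_sets[OF refl sets_lborel])

lemma nn_integral_gauss_1dim:
  fixes c m :: real
  assumes c: "c > 0"
  shows "(\<integral>\<^sup>+y. ennreal (exp (- (c * (y + m)\<^sup>2) / 2)) \<partial>lborel) = ennreal (sqrt (2 * pi / c))"
proof -
  have s: "1 / sqrt c > 0" using c by simp
  have "1 = emeasure (density lborel (normal_density (- m) (1 / sqrt c))) UNIV"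
    using prob_space.emeasure_space_1[OF prob_space_normal_density[OF s]] by simp
  also have "\<dots> = (\<integral>\<^sup>+y. ennreal (normal_density (- m) (1 / sqrt c) y) \<partial>lborel)"
    by (subst emeasure_density) auto
  finally have 1: "(\<integral>\<^sup>+y. ennreal (normal_density (- m) (1 / sqrt c) y) \<partial>lborel) = 1" by simp
  have "exp (- (c * (y + m)\<^sup>2) / 2) = sqrt (2 * pi / c) * normal_density (- m) (1 / sqrt c) y" for y
    using c by (simp add: normal_density_def real_sqrt_divide power_divide)
  then have "(\<integral>\<^sup>+y. ennreal (exp (- (c * (y + m)\<^sup>2) / 2)) \<partial>lborel)
     = (\<integral>\<^sup>+y. ennreal (sqrt (2 * pi / c)) * ennreal (normal_density (- m) (1 / sqrt c) y) \<partial>lborel)"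
    using c by (simp add: ennreal_mult)
  also have "\<dots> = ennreal (sqrt (2 * pi / c))"
    by (subst nn_integral_cmult) (auto simp: 1)
  finally show ?thesis .
qed

text \<open>Block elimination: the matrix is a unit upper block triangular factor times a lower
  block triangular one whose diagonal blocks are the Schur complement and the pivot
  \<open>A p p\<close>.\<close>

lemma det_schur_complement_last:
  fixes A :: "nat \<Rightarrow> nat \<Rightarrow> real"
  assumes c: "A p p \<noteq> 0" and sym: "\<And>i j. i < Suc p \<Longrightarrow> j < Suc p \<Longrightarrow> A i j = A j i"
  shows "det (mat (Suc p) (Suc p) (\<lambda>(i,j). A i j))
    = A p p * det (mat p p (\<lambda>(i,j). A i j - A i p * A j p / A p p))"
proof -
  let ?c = "A p p"
  let ?S = "mat p p (\<lambda>(i,j). A i j - A i p * A j p / ?c)"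
  let ?b = "mat p 1 (\<lambda>(i,_). A i p / ?c)"
  let ?r = "mat 1 p (\<lambda>(_,j). A j p)"
  let ?L = "four_block_mat (1\<^sub>m p) ?b (0\<^sub>m 1 p) (1\<^sub>m 1)"
  let ?N = "four_block_mat ?S (0\<^sub>m p 1) ?r (mat 1 1 (\<lambda>_. ?c))"
  have "?L * ?N = four_block_mat (?S + ?b * ?r) (?b * mat 1 1 (\<lambda>_. ?c)) ?r (mat 1 1 (\<lambda>_. ?c))"
    by (subst mult_four_block_mat[of _ p p _ 1 _ 1 _ _ p _ 1]) auto
  also have "\<dots> = mat (Suc p) (Suc p) (\<lambda>(i,j). A i j)"
  proof (rule eq_matI)
    fix i j assume "i < dim_row (mat (Suc p) (Suc p) (\<lambda>(i,j). A i j))"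
      "j < dim_col (mat (Suc p) (Suc p) (\<lambda>(i,j). A i j))"
    then have ij: "i < Suc p" "j < Suc p" by auto
    then consider "i < p" "j < p" | "i < p" "j = p" | "i = p" "j < p" | "i = p" "j = p" by linarith
    then show "four_block_mat (?S + ?b * ?r) (?b * mat 1 1 (\<lambda>_. ?c)) ?r (mat 1 1 (\<lambda>_. ?c)) $$ (i,j)
       = mat (Suc p) (Suc p) (\<lambda>(i,j). A i j) $$ (i,j)"
      using c sym[of p j] by cases (auto simp: scalar_prod_def)
  qed auto
  finally have "det (mat (Suc p) (Suc p) (\<lambda>(i,j). A i j)) = det (?L * ?N)" by simp
  also have "\<dots> = det ?L * det ?N"
    by (rule det_mult[of _ "p + 1"]) (auto intro!: four_block_carrier_mat)
  also have "det ?L = 1"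
    by (subst det_four_block_mat_lower_left_zero[of _ p _ 1]) auto
  also have "det ?N = det ?S * det (mat 1 1 (\<lambda>_. ?c))"
    by (rule det_four_block_mat_upper_right_zero) auto
  also have "det (mat 1 1 (\<lambda>_. ?c)) = ?c" by (simp add: det_def sign_def)
  finally show ?thesis by simp
qed

text \<open>Induction on the dimension by completing the square in the last coordinate. Integrating
  that coordinate gives a one-dimensional Gaussian of precision \<open>c\<close> and leaves the form
  of the Schur complement, whose determinant is smaller by the factor \<open>c\<close>. With entries
  given by a function, the induction restricts to smaller index ranges without handling
  submatrices.\<close>

lemma nn_integral_gauss_fun:
  fixes A :: "nat \<Rightarrow> nat \<Rightarrow> real"
  assumes "\<And>i j. i < p \<Longrightarrow> j < p \<Longrightarrow> A i j = A j i"
    and "\<And>x :: nat \<Rightarrow> real. (\<exists>i<p. x i \<noteq> 0) \<Longrightarrow> 0 < (\<Sum>i<p. \<Sum>j<p. x i * A i j * x j)"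
  shows "det (mat p p (\<lambda>(i,j). A i j)) > 0 \<and>
    (\<integral>\<^sup>+x. ennreal (exp (- (\<Sum>i<p. \<Sum>j<p. x i * A i j * x j) / 2)) \<partial>PiM {..<p} (\<lambda>_. lborel))
      = ennreal ((2 * pi) powr (real p / 2) / sqrt (det (mat p p (\<lambda>(i,j). A i j))))"
  using assms
proof (induction p arbitrary: A)
  case 0
  then show ?case by (simp add: det_def PiM_empty nn_integral_count_space_finite)
next
  case (Suc p A)
  note sym = Suc.prems(1) and pd = Suc.prems(2)
  interpret product_sigma_finite "\<lambda>_::nat. lborel :: real measure"
    by (simp add: product_sigma_finite_def sigma_finite_lborel)
  define c where "c = A p p"
  define S where "S i j = A i j - A i p * A j p / c" for i j
  define b where "b x = (\<Sum>i<p. A i p * x i)" for x :: "nat \<Rightarrow> real"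
  have c: "c > 0"
    using pd[of "\<lambda>i. if i = p then 1 else 0"]
    by (simp add: c_def if_distrib[of "\<lambda>x. x * _"] if_distrib[of "\<lambda>x. _ * x"] cong: if_cong)
  have quad: "(\<Sum>i<Suc p. \<Sum>j<Suc p. x i * A i j * x j)
      = (\<Sum>i<p. \<Sum>j<p. x i * S i j * x j) + c * (x p + b x / c)\<^sup>2" for x
  proof -
    have "(\<Sum>i<Suc p. \<Sum>j<Suc p. x i * A i j * x j)
       = (\<Sum>i<p. \<Sum>j<p. x i * A i j * x j) + (\<Sum>i<p. x i * A i p * x p) + (\<Sum>j<p. x p * A p j * x j) + x p * c * x p"
      by (simp add: sum.distrib c_def)
    also have "(\<Sum>i<p. x i * A i p * x p) = x p * b x"
      unfolding b_def sum_distrib_left by (simp add: mult_ac)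
    also have "(\<Sum>j<p. x p * A p j * x j) = x p * b x"
      unfolding b_def sum_distrib_left by (intro sum.cong refl) (simp add: sym[of p])
    also have "(\<Sum>i<p. \<Sum>j<p. x i * A i j * x j)
       = (\<Sum>i<p. \<Sum>j<p. x i * S i j * x j) + (\<Sum>i<p. \<Sum>j<p. (A i p * x i) * (A j p * x j) / c)"
      unfolding sum.distrib[symmetric] by (intro sum.cong refl) (simp add: S_def field_simps)
    also have "(\<Sum>i<p. \<Sum>j<p. (A i p * x i) * (A j p * x j) / c) = b x * b x / c"
      unfolding b_def sum_product sum_divide_distrib ..
    finally show ?thesis using c by (simp add: power2_eq_square field_simps)
  qed
  have S_sym: "S i j = S j i" if "i < p" "j < p" for i j using sym[of i j] that by (simp add: S_def)
  have S_pd: "0 < (\<Sum>i<p. \<Sum>j<p. x i * S i j * x j)" if "\<exists>i<p. x i \<noteq> 0" for x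
  proof -
    \<comment> \<open>The last coordinate at which the completed square vanishes: there the form of
      \<open>A\<close> agrees with the form of its Schur complement.\<close>
    let ?x = "x(p := - b x / c)"
    have "b ?x = b x" unfolding b_def by (intro sum.cong) auto
    moreover have "(\<Sum>i<p. \<Sum>j<p. ?x i * S i j * ?x j) = (\<Sum>i<p. \<Sum>j<p. x i * S i j * x j)"
      by (intro sum.cong) auto
    moreover have "\<exists>i<Suc p. ?x i \<noteq> 0" using that by (metis fun_upd_other less_SucI nat_neq_iff)
    ultimately show ?thesis using pd[of ?x] quad[of ?x] by simp
  qed
  let ?dS = "det (mat p p (\<lambda>(i,j). S i j))"
  have IH: "?dS > 0" "(\<integral>\<^sup>+x. ennreal (exp (- (\<Sum>i<p. \<Sum>j<p. x i * S i j * x j) / 2)) \<partial>PiM {..<p} (\<lambda>_. lborel))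
      = ennreal ((2 * pi) powr (real p / 2) / sqrt ?dS)"
    using Suc.IH[OF S_sym S_pd] by auto
  have det: "det (mat (Suc p) (Suc p) (\<lambda>(i,j). A i j)) = c * ?dS"
    unfolding c_def S_def using c sym by (intro det_schur_complement_last) (auto simp: c_def)
  have ins: "{..<Suc p} = insert p {..<p}" by auto
  have "(\<integral>\<^sup>+x. ennreal (exp (- (\<Sum>i<Suc p. \<Sum>j<Suc p. x i * A i j * x j) / 2)) \<partial>PiM {..<Suc p} (\<lambda>_. lborel))
    = (\<integral>\<^sup>+x. (\<integral>\<^sup>+y. ennreal (exp (- (\<Sum>i<Suc p. \<Sum>j<Suc p. (x(p:=y)) i * A i j * (x(p:=y)) j) / 2)) \<partial>lborel)
        \<partial>PiM {..<p} (\<lambda>_. lborel))"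
    unfolding ins
    by (rule product_nn_integral_insert) (auto simp: ins[symmetric] intro!: measurable_component_singleton)
  also have "\<dots> = (\<integral>\<^sup>+x. ennreal (exp (- (\<Sum>i<p. \<Sum>j<p. x i * S i j * x j) / 2)) * ennreal (sqrt (2 * pi / c))
        \<partial>PiM {..<p} (\<lambda>_. lborel))"
  proof (rule nn_integral_cong)
    fix x :: "nat \<Rightarrow> real"
    have "(\<integral>\<^sup>+y. ennreal (exp (- (\<Sum>i<Suc p. \<Sum>j<Suc p. (x(p:=y)) i * A i j * (x(p:=y)) j) / 2)) \<partial>lborel)
      = (\<integral>\<^sup>+y. ennreal (exp (- (\<Sum>i<p. \<Sum>j<p. x i * S i j * x j) / 2)) * ennreal (exp (- (c * (y + b x / c)\<^sup>2) / 2)) \<partial>lborel)"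
    proof (rule nn_integral_cong)
      fix y
      have "b (x(p := y)) = b x" unfolding b_def by (intro sum.cong) auto
      moreover have "(\<Sum>i<p. \<Sum>j<p. (x(p := y)) i * S i j * (x(p := y)) j) = (\<Sum>i<p. \<Sum>j<p. x i * S i j * x j)"
        by (intro sum.cong) auto
      ultimately show "ennreal (exp (- (\<Sum>i<Suc p. \<Sum>j<Suc p. (x(p:=y)) i * A i j * (x(p:=y)) j) / 2))
        = ennreal (exp (- (\<Sum>i<p. \<Sum>j<p. x i * S i j * x j) / 2)) * ennreal (exp (- (c * (y + b x / c)\<^sup>2) / 2))"
        unfolding quad[of "x(p := y)"] by (simp add: ennreal_mult[symmetric] exp_add[symmetric] add_divide_distrib)
    qed
    also have "\<dots> = ennreal (exp (- (\<Sum>i<p. \<Sum>j<p. x i * S i j * x j) / 2)) * ennreal (sqrt (2 * pi / c))"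
      by (subst nn_integral_cmult, simp, simp only: nn_integral_gauss_1dim[OF c])
    finally show "(\<integral>\<^sup>+y. ennreal (exp (- (\<Sum>i<Suc p. \<Sum>j<Suc p. (x(p:=y)) i * A i j * (x(p:=y)) j) / 2)) \<partial>lborel)
      = ennreal (exp (- (\<Sum>i<p. \<Sum>j<p. x i * S i j * x j) / 2)) * ennreal (sqrt (2 * pi / c))" .
  qed
  also have "\<dots> = ennreal ((2 * pi) powr (real p / 2) / sqrt ?dS) * ennreal (sqrt (2 * pi / c))"
    unfolding IH(2)[symmetric]
    by (rule nn_integral_multc) (auto intro!: measurable_component_singleton)
  also have "\<dots> = ennreal ((2 * pi) powr (real (Suc p) / 2) / sqrt (c * ?dS))"
  proof -
    have "(2 * pi) powr (real (Suc p) / 2) = (2 * pi) powr (real p / 2) * sqrt (2 * pi)"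
      by (simp add: add_divide_distrib powr_add powr_half_sqrt)
    then show ?thesis using c IH(1)
      by (simp add: ennreal_mult[symmetric] real_sqrt_mult real_sqrt_divide)
  qed
  finally show ?case using det c IH(1) by simp
qed

lemma quad_form_sum:
  fixes A :: "real mat"
  assumes "A \<in> carrier_mat p p"
  shows "vec p x \<bullet> (A *\<^sub>v vec p x) = (\<Sum>i<p. \<Sum>j<p. x i * A $$ (i,j) * x j)"
  using assms by (auto simp: scalar_prod_def lessThan_atLeast0 sum_distrib_left mult_ac intro!: sum.cong)

lemma nn_integral_gauss:
  assumes A: "A \<in> carrier_mat p p" and pd: "pos_def A"
  shows "det A > 0"
    and "(\<integral>\<^sup>+x. ennreal (exp (- (\<Sum>i<p. \<Sum>j<p. x i * A $$ (i,j) * x j) / 2)) \<partial>PiM {..<p} (\<lambda>_. lborel))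
      = ennreal ((2 * pi) powr (real p / 2) / sqrt (det A))"
proof -
  have Am: "mat p p (\<lambda>(i,j). A $$ (i,j)) = A" using A by (intro eq_matI) auto
  have sym: "A $$ (i,j) = A $$ (j,i)" if "i < p" "j < p" for i j
    using pd A that unfolding pos_def_def sym_mat_def by auto
  have pos: "0 < (\<Sum>i<p. \<Sum>j<p. x i * A $$ (i,j) * x j)" if nz: "\<exists>i<p. x i \<noteq> 0" for x :: "nat \<Rightarrow> real"
  proof -
    obtain i where i: "i < p" "x i \<noteq> 0" using nz by auto
    have "vec p x \<noteq> 0\<^sub>v p" using i by (metis index_vec index_zero_vec(1))
    then show ?thesis using pd A unfolding pos_def_def quad_form_sum[OF A, symmetric] by auto
  qed
  show "det A > 0"
    and "(\<integral>\<^sup>+x. ennreal (exp (- (\<Sum>i<p. \<Sum>j<p. x i * A $$ (i,j) * x j) / 2)) \<partial>PiM {..<p} (\<lambda>_. lborel))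
      = ennreal ((2 * pi) powr (real p / 2) / sqrt (det A))"
    using nn_integral_gauss_fun[of p "\<lambda>i j. A $$ (i,j)", OF sym pos] unfolding Am by auto
qed

lemma measurable_gauss_dens [measurable]:
  "gauss_dens p A \<in> borel_measurable (PiM {..<p} (\<lambda>_. lborel))"
  unfolding gauss_dens_def by (auto intro!: measurable_component_singleton)

text \<open>Exponential tilting by a quadratic form replaces the precision \<open>A\<close> by
  \<open>A + T\<close>, so the expectation is the quotient of the two normalizing constants.\<close>

lemma gauss_vec_mgf:
  assumes A: "A \<in> carrier_mat p p" and pd: "pos_def A"
    and T: "T \<in> carrier_mat p p" and pdT: "pos_def (A + T)"
  shows "(\<integral>\<^sup>+x. ennreal (exp (- (\<Sum>i<p. \<Sum>j<p. x i * T $$ (i,j) * x j) / 2)) \<partial>gauss_vec p A)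
    = ennreal (sqrt (det A / det (A + T)))"
proof -
  have AT: "A + T \<in> carrier_mat p p" using A T by simp
  note dA = nn_integral_gauss(1)[OF A pd] and dAT = nn_integral_gauss(1)[OF AT pdT]
  let ?K = "(2 * pi) powr (- real p / 2) * sqrt (det A)"
  have "(\<integral>\<^sup>+x. ennreal (exp (- (\<Sum>i<p. \<Sum>j<p. x i * T $$ (i,j) * x j) / 2)) \<partial>gauss_vec p A)
     = (\<integral>\<^sup>+x. ennreal (gauss_dens p A x) * ennreal (exp (- (\<Sum>i<p. \<Sum>j<p. x i * T $$ (i,j) * x j) / 2))
         \<partial>PiM {..<p} (\<lambda>_. lborel))"
    unfolding gauss_vec_def by (rule nn_integral_density) (auto intro!: measurable_component_singleton)
  also have "\<dots> = (\<integral>\<^sup>+x. ennreal ?K * ennreal (exp (- (\<Sum>i<p. \<Sum>j<p. x i * (A + T) $$ (i,j) * x j) / 2))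
         \<partial>PiM {..<p} (\<lambda>_. lborel))"
  proof (rule nn_integral_cong)
    fix x :: "nat \<Rightarrow> real"
    have "(\<Sum>i<p. \<Sum>j<p. x i * (A + T) $$ (i,j) * x j)
      = (\<Sum>i<p. \<Sum>j<p. x i * A $$ (i,j) * x j) + (\<Sum>i<p. \<Sum>j<p. x i * T $$ (i,j) * x j)"
      unfolding sum.distrib[symmetric] using A T by (intro sum.cong refl) (auto simp: algebra_simps)
    then have "exp (- (\<Sum>i<p. \<Sum>j<p. x i * (A + T) $$ (i,j) * x j) / 2)
      = exp (- (\<Sum>i<p. \<Sum>j<p. x i * A $$ (i,j) * x j) / 2) * exp (- (\<Sum>i<p. \<Sum>j<p. x i * T $$ (i,j) * x j) / 2)"
      by (simp add: exp_add[symmetric] add_divide_distrib)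
    then show "ennreal (gauss_dens p A x) * ennreal (exp (- (\<Sum>i<p. \<Sum>j<p. x i * T $$ (i,j) * x j) / 2))
      = ennreal ?K * ennreal (exp (- (\<Sum>i<p. \<Sum>j<p. x i * (A + T) $$ (i,j) * x j) / 2))"
      using dA by (simp add: gauss_dens_def ennreal_mult[symmetric] mult.assoc)
  qed
  also have "\<dots> = ennreal ?K * ennreal ((2 * pi) powr (real p / 2) / sqrt (det (A + T)))"
    unfolding nn_integral_gauss(2)[OF AT pdT, symmetric]
    by (rule nn_integral_cmult) (auto intro!: measurable_component_singleton)
  also have "\<dots> = ennreal (sqrt (det A / det (A + T)))"
  proof -
    have "(2 * pi) powr (- real p / 2) * (2 * pi) powr (real p / 2) = 1"
      by (simp add: powr_add[symmetric])
    then have "?K * ((2 * pi) powr (real p / 2) / sqrt (det (A + T))) = sqrt (det A / det (A + T))"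
      by (simp add: real_sqrt_divide)
    then show ?thesis using dA dAT by (simp add: ennreal_mult[symmetric])
  qed
  finally show ?thesis .
qed

lemma prob_space_gauss_vec:
  assumes A: "A \<in> carrier_mat p p" and pd: "pos_def A"
  shows "prob_space (gauss_vec p A)"
proof
  \<comment> \<open>Total mass one is the case of tilting by zero.\<close>
  have "A + 0\<^sub>m p p = A" using A by simp
  then have "(\<integral>\<^sup>+x. 1 \<partial>gauss_vec p A) = 1"
    using gauss_vec_mgf[OF A pd, of "0\<^sub>m p p"] pd nn_integral_gauss(1)[OF A pd] by simp
  then show "emeasure (gauss_vec p A) (space (gauss_vec p A)) = 1" by simp
qed

section \<open>Moments of the scatter matrix\<close>

text \<open>The constant 2 is dictated by negative \<open>m\<close>; for positive \<open>m\<close>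
  already \<open>m - m\<^sup>2\<close> lies below \<open>ln (1 + m)\<close>.\<close>

lemma exp_le_one_plus:
  fixes m :: real
  assumes "\<bar>m\<bar> \<le> 1 / 2"
  shows "exp (m - 2 * m\<^sup>2) \<le> 1 + m"
proof -
  have "m - 2 * m\<^sup>2 \<le> ln (1 + m)"
  proof (cases "m \<ge> 0")
    case True
    then have "m - m\<^sup>2 \<le> ln (1 + m)" using assms by (intro ln_one_plus_pos_lower_bound) auto
    then show ?thesis using zero_le_power2[of m] by linarith
  next
    case False
    then show ?thesis using ln_one_minus_pos_lower_bound[of "- m"] assms by simp
  qed
  then have "exp (m - 2 * m\<^sup>2) \<le> exp (ln (1 + m))" by simp
  also have "\<dots> = 1 + m" using assms by (subst exp_ln) auto
  finally show ?thesis .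
qed

text \<open>The smallness of \<open>\<Delta>\<close> forces every \<open>\<mu> i\<close> into the
  interval from \<open>-1/2\<close> to \<open>1/2\<close>, where the quadratic bound for
  \<open>ln (1 + m)\<close> applies factor by factor. It serves twice: for the moment generating
  function of the data and for the denominator of the posterior.\<close>

lemma det_perturbation_lower:
  assumes A: "A \<in> carrier_mat n n" and sp: "spectral_perturbation n k A S" and k: "k > 0"
    and D: "\<Delta> \<in> carrier_mat n n" "\<Delta>\<^sup>T = \<Delta>" and small: "frob_sq n \<Delta> \<le> k\<^sup>2 / 4"
  shows "pos_def (A + \<Delta>)" "det (A + \<Delta>) \<ge> det A * exp (frob_inner n S \<Delta> - 2 * frob_sq n \<Delta> / k\<^sup>2)"
proof -
  obtain \<mu> where mu: "det (A + \<Delta>) = det A * (\<Prod>i<n. 1 + \<mu> i)" "(\<Sum>i<n. \<mu> i) = frob_inner n S \<Delta>"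
    "(\<Sum>i<n. (\<mu> i)\<^sup>2) \<le> frob_sq n \<Delta> / k\<^sup>2" "pos_def (A + \<Delta>) \<longleftrightarrow> (\<forall>i<n. 1 + \<mu> i > 0)" and dA: "det A > 0"
    using sp D unfolding spectral_perturbation_def by blast
  have "frob_sq n \<Delta> / k\<^sup>2 \<le> 1 / 4" using small k by (simp add: field_simps)
  with mu(3) have "(\<Sum>i<n. (\<mu> i)\<^sup>2) \<le> 1 / 4" by linarith
  also have "1 / 4 = (1 / 2 :: real)\<^sup>2" by (simp add: power2_eq_square)
  finally have mu4: "(\<Sum>i<n. (\<mu> i)\<^sup>2) \<le> (1 / 2)\<^sup>2" .
  have m: "\<bar>\<mu> i\<bar> \<le> 1 / 2" if "i < n" for i
  proof -
    have "(\<mu> i)\<^sup>2 \<le> (\<Sum>i<n. (\<mu> i)\<^sup>2)" using that by (intro member_le_sum) auto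
    then have "(\<mu> i)\<^sup>2 \<le> (1 / 2)\<^sup>2" using mu4 by linarith
    then show ?thesis by (metis abs_le_square_iff abs_numeral abs_divide abs_one)
  qed
  show "pos_def (A + \<Delta>)" unfolding mu(4)
  proof (intro allI impI)
    fix i assume "i < n" then show "1 + \<mu> i > 0" using m[of i] by linarith
  qed
  have "exp (frob_inner n S \<Delta> - 2 * frob_sq n \<Delta> / k\<^sup>2) \<le> exp (\<Sum>i<n. \<mu> i - 2 * (\<mu> i)\<^sup>2)"
    unfolding exp_le_cancel_iff sum_subtractf mu(2) sum_distrib_left[symmetric] using mu(3) by simp
  also have "\<dots> = (\<Prod>i<n. exp (\<mu> i - 2 * (\<mu> i)\<^sup>2))" by (rule exp_sum) simp
  also have "\<dots> \<le> (\<Prod>i<n. 1 + \<mu> i)"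
    using m by (intro prod_mono conjI exp_le_one_plus) auto
  finally show "det (A + \<Delta>) \<ge> det A * exp (frob_inner n S \<Delta> - 2 * frob_sq n \<Delta> / k\<^sup>2)"
    unfolding mu(1) using dA by (intro mult_left_mono) auto
qed

text \<open>The product of two coordinates is itself a quadratic form, so tilting applies. The
  linear term of the determinant bound cancels the centring at \<open>S $$ (a,b)\<close> and the
  quadratic term leaves a Gaussian-type bound in \<open>s\<close>.\<close>

lemma gauss_vec_product_mgf:
  assumes A: "A \<in> carrier_mat p p" and pd: "pos_def A"
    and sp: "spectral_perturbation p k A S" and k: "k > 0"
    and ab: "a < p" "b < p" and s: "\<bar>s\<bar> \<le> k / 4"
  shows "(\<integral>\<^sup>+x. ennreal (exp (s * (x a * x b - S $$ (a,b)))) \<partial>gauss_vec p A) \<le> ennreal (exp (4 * s\<^sup>2 / k\<^sup>2))"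
proof -
  \<comment> \<open>Symmetrized so that the quadratic form is \<open>- 2 * s * x a * x b\<close>.
    For \<open>a = b\<close> both terms fall on one diagonal entry; this is the case that attains
    \<open>frob_sq p T = 4 * s\<^sup>2\<close>.\<close>
  define T where "T = mat p p (\<lambda>(i,j). - s * (of_bool (i = a) * of_bool (j = b) + of_bool (i = b) * of_bool (j = a)))"
  have T: "T \<in> carrier_mat p p" "T\<^sup>T = T" by (auto simp: T_def intro!: eq_matI)
  have single: "(\<Sum>i<p. \<Sum>j<p. if i = a' then (if j = b' then g i j else 0) else 0) = g a' b'"
    if "a' < p" "b' < p" for a' b' and g :: "nat \<Rightarrow> nat \<Rightarrow> real"
  proof -
    have "(\<Sum>i<p. \<Sum>j<p. if i = a' then (if j = b' then g i j else 0) else 0)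
      = (\<Sum>i<p. if i = a' then (\<Sum>j<p. if j = b' then g i j else 0) else 0)"
      by (intro sum.cong refl) auto
    also have "\<dots> = g a' b'" using that by simp
    finally show ?thesis .
  qed
  have Tsum: "(\<Sum>i<p. \<Sum>j<p. f i j * T $$ (i,j)) = - s * (f a b + f b a)" for f
  proof -
    have "(\<Sum>i<p. \<Sum>j<p. f i j * T $$ (i,j))
       = (\<Sum>i<p. \<Sum>j<p. (if i = a then (if j = b then - s * f i j else 0) else 0) + (if i = b then (if j = a then - s * f i j else 0) else 0))"
      by (intro sum.cong refl) (auto simp: T_def algebra_simps)
    also have "\<dots> = - s * (f a b + f b a)"
      by (simp only: sum.distrib single[OF ab] single[OF ab(2,1)]) (simp add: algebra_simps)
    finally show ?thesis .
  qed
  have Ssym: "S $$ (b,a) = S $$ (a,b)"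
  proof -
    have "S \<in> carrier_mat p p" "S\<^sup>T = S" using sp by (auto simp: spectral_perturbation_def)
    then show ?thesis using ab by (metis carrier_matD index_transpose_mat(1))
  qed
  have mS: "frob_inner p S T = - 2 * s * S $$ (a,b)" unfolding frob_inner_def Tsum Ssym by simp
  have "frob_sq p T = (\<Sum>i<p. \<Sum>j<p. T $$ (i,j) * T $$ (i,j))" by (simp add: frob_sq_def power2_eq_square)
  also have "\<dots> = - s * (T $$ (a,b) + T $$ (b,a))" by (rule Tsum)
  also have "\<dots> \<le> 4 * s\<^sup>2" using ab by (simp add: T_def power2_eq_square)
  finally have fT: "frob_sq p T \<le> 4 * s\<^sup>2" .
  \<comment> \<open>The range of \<open>s\<close> is chosen so that \<open>4 * s\<^sup>2\<close>
    meets exactly the smallness \<open>k\<^sup>2 / 4\<close> needed for the determinant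
    bound.\<close>
  have "s\<^sup>2 \<le> (k / 4)\<^sup>2" using s k by (metis abs_ge_zero power2_abs power_mono)
  then have "frob_sq p T \<le> k\<^sup>2 / 4" using fT by (simp add: power2_eq_square)
  note d = det_perturbation_lower[OF A sp k T this]
  have AT: "A + T \<in> carrier_mat p p" using A T by simp
  have dA: "det A > 0" "det (A + T) > 0" using nn_integral_gauss(1) A pd AT d(1) by blast+
  have eq: "exp (s * (x a * x b - S $$ (a,b)))
     = exp (- (s * S $$ (a,b))) * exp (- (\<Sum>i<p. \<Sum>j<p. x i * T $$ (i,j) * x j) / 2)" for x :: "nat \<Rightarrow> real"
  proof -
    have "(\<Sum>i<p. \<Sum>j<p. x i * T $$ (i,j) * x j) = (\<Sum>i<p. \<Sum>j<p. (x i * x j) * T $$ (i,j))" by (simp add: mult_ac)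
    then show ?thesis unfolding Tsum by (simp add: exp_add[symmetric] algebra_simps)
  qed
  have "(\<integral>\<^sup>+x. ennreal (exp (s * (x a * x b - S $$ (a,b)))) \<partial>gauss_vec p A)
    = ennreal (exp (- (s * S $$ (a,b)))) * ennreal (sqrt (det A / det (A + T)))"
    unfolding eq gauss_vec_mgf[OF A pd T(1) d(1), symmetric]
    by (simp only: ennreal_mult'' exp_ge_zero, rule nn_integral_cmult)
       (auto simp: gauss_vec_def intro!: measurable_lborel_component)
  also have "\<dots> = ennreal (exp (- (s * S $$ (a,b))) * sqrt (det A / det (A + T)))"
    using dA by (simp add: ennreal_mult)
  also have "\<dots> \<le> ennreal (exp (4 * s\<^sup>2 / k\<^sup>2))"
  proof (rule ennreal_leI)
    let ?e = "frob_inner p S T - 2 * frob_sq p T / k\<^sup>2"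
    have "det A / det (A + T) \<le> det A / (det A * exp ?e)"
      using dA d(2) by (intro divide_left_mono) auto
    also have "\<dots> = exp (- ?e)" using dA by (simp add: exp_minus inverse_eq_divide del: minus_diff_eq)
    finally have "sqrt (det A / det (A + T)) \<le> sqrt (exp (- ?e))" by simp
    also have "\<dots> = exp (- ?e / 2)" by (simp add: exp_half_le2 real_sqrt_unique power2_eq_square exp_add[symmetric])
    also have "\<dots> = exp (s * S $$ (a,b)) * exp (frob_sq p T / k\<^sup>2)"
      unfolding mS by (simp add: exp_add[symmetric] field_simps)
    finally have "exp (- (s * S $$ (a,b))) * sqrt (det A / det (A + T)) \<le>
       exp (- (s * S $$ (a,b))) * (exp (s * S $$ (a,b)) * exp (frob_sq p T / k\<^sup>2))"
      by (intro mult_left_mono) auto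
    also have "\<dots> = exp (frob_sq p T / k\<^sup>2)" by (simp add: exp_add[symmetric])
    also have "\<dots> \<le> exp (4 * s\<^sup>2 / k\<^sup>2)" using fT k by (simp add: divide_right_mono)
    finally show "exp (- (s * S $$ (a,b))) * sqrt (det A / det (A + T)) \<le> exp (4 * s\<^sup>2 / k\<^sup>2)" .
  qed
  finally show ?thesis .
qed

text \<open>Second moments of the scatter matrix are read off its moment generating function at
  \<open>s\<close> of order \<open>1 / sqrt n\<close>; that function is a ratio of Gaussian normalising constants, so no
  moment of the Gaussian has to be integrated directly.\<close>

lemma square_le_exp_sum: "(z::real)\<^sup>2 \<le> 2 * (exp z + exp (- z))"
proof -
  have *: "(z::real)\<^sup>2 \<le> 2 * (exp z + exp (- z))" if "z \<ge> 0" for z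
    using exp_lower_Taylor_quadratic[OF that] that by (smt (verit) exp_gt_zero field_sum_of_halves)
  show ?thesis using *[of z] *[of "- z"] by (cases "z \<ge> 0") (auto simp: add.commute)
qed

lemma measurable_sample_component:
  assumes "k < n" "a < p"
  shows "(\<lambda>Y. Y k a) \<in> borel_measurable (sample_measure n p A)"
proof -
  have 1: "(\<lambda>Y. Y k) \<in> measurable (sample_measure n p A) (gauss_vec p A)"
    unfolding sample_measure_def using assms by (intro measurable_component_singleton) auto
  have 2: "(\<lambda>y. y a) \<in> borel_measurable (gauss_vec p A)"
    unfolding gauss_vec_def using assms by (simp add: measurable_lborel_component)
  show ?thesis using measurable_compose[OF 1 2] .
qed

lemma sample_mgf:
  assumes A: "A \<in> carrier_mat p p" and pd: "pos_def A"
    and sp: "spectral_perturbation p k A S" and k: "k > 0"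
    and ab: "a < p" "b < p" and s: "\<bar>s\<bar> \<le> k / 4"
  shows "(\<integral>\<^sup>+Y. ennreal (exp (s * (\<Sum>i<n. Y i a * Y i b - S $$ (a,b)))) \<partial>sample_measure n p A)
    \<le> ennreal (exp (4 * s\<^sup>2 / k\<^sup>2) ^ n)"
proof -
  interpret product_sigma_finite "\<lambda>_::nat. gauss_vec p A"
    unfolding product_sigma_finite_def
    using prob_space_gauss_vec[OF A pd] by (simp add: prob_space_imp_sigma_finite)
  have "(\<integral>\<^sup>+Y. ennreal (exp (s * (\<Sum>i<n. Y i a * Y i b - S $$ (a,b)))) \<partial>sample_measure n p A)
    = (\<integral>\<^sup>+Y. (\<Prod>i<n. ennreal (exp (s * (Y i a * Y i b - S $$ (a,b))))) \<partial>sample_measure n p A)"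
    unfolding sum_distrib_left by (simp add: exp_sum prod_ennreal)
  also have "\<dots> = (\<Prod>i<n. \<integral>\<^sup>+x. ennreal (exp (s * (x a * x b - S $$ (a,b)))) \<partial>gauss_vec p A)"
    unfolding sample_measure_def
  proof (rule product_nn_integral_prod)
    have [measurable]: "(\<lambda>x. x a) \<in> borel_measurable (PiM {..<p} (\<lambda>_. lborel))"
      "(\<lambda>x. x b) \<in> borel_measurable (PiM {..<p} (\<lambda>_. lborel))"
      using ab by (auto intro: measurable_lborel_component)
    show "(\<lambda>x. ennreal (exp (s * (x a * x b - S $$ (a,b))))) \<in> borel_measurable (gauss_vec p A)"
      unfolding gauss_vec_def by simp
  qed simp
  also have "\<dots> \<le> (\<Prod>i<n. ennreal (exp (4 * s\<^sup>2 / k\<^sup>2)))"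
    by (intro prod_mono_ennreal gauss_vec_product_mgf[OF assms])
  also have "\<dots> = ennreal (exp (4 * s\<^sup>2 / k\<^sup>2) ^ n)" by (simp add: ennreal_power)
  finally show ?thesis .
qed

lemma sample_second_moment:
  assumes A: "A \<in> carrier_mat p p" and pd: "pos_def A"
    and sp: "spectral_perturbation p k A S" and k: "k > 0"
    and ab: "a < p" "b < p" and n: "n > 0"
  shows "(\<integral>\<^sup>+Y. ennreal ((\<Sum>i<n. Y i a * Y i b - S $$ (a,b))\<^sup>2) \<partial>sample_measure n p A)
    \<le> ennreal (real n * (192 / k\<^sup>2))"
proof -
  let ?Z = "\<lambda>Y. \<Sum>i<n. Y i a * Y i b - S $$ (a,b)"
  \<comment> \<open>This choice makes the generating function of the whole sum at most
    \<open>exp (1 / 4)\<close>, independently of \<open>n\<close>. Bounding it by 3 at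
    \<open>s\<close> and at \<open>- s\<close> gives \<open>2 / s\<^sup>2 * 6\<close>, and
    \<open>1 / s\<^sup>2 = 16 * n / k\<^sup>2\<close> turns this into the constant 192.\<close>
  define s where "s = k / (4 * sqrt n)"
  have s0: "s > 0" using k n by (simp add: s_def)
  have s: "\<bar>s\<bar> \<le> k / 4" "\<bar>- s\<bar> \<le> k / 4" using k n s0 by (auto simp: s_def divide_le_eq)
  have s2: "s\<^sup>2 = k\<^sup>2 / (16 * real n)" using n by (simp add: s_def power_divide power_mult_distrib)
  have "exp (4 * s\<^sup>2 / k\<^sup>2) ^ n = exp (1 / 4)"
    using k n by (simp add: exp_of_nat_mult[symmetric] s2)
  also have "\<dots> \<le> exp 1" by simp
  also have "\<dots> \<le> 3" using exp_le by simp
  finally have e3: "exp (4 * s\<^sup>2 / k\<^sup>2) ^ n \<le> 3" .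
  have meas: "?Z \<in> borel_measurable (sample_measure n p A)"
    using ab by (intro borel_measurable_sum borel_measurable_diff borel_measurable_times measurable_sample_component) auto
  have "(\<integral>\<^sup>+Y. ennreal ((?Z Y)\<^sup>2) \<partial>sample_measure n p A)
    \<le> (\<integral>\<^sup>+Y. ennreal (2 / s\<^sup>2) * (ennreal (exp (s * ?Z Y)) + ennreal (exp (- s * ?Z Y))) \<partial>sample_measure n p A)"
  proof (rule nn_integral_mono)
    fix Y
    have "(s * ?Z Y)\<^sup>2 \<le> 2 * (exp (s * ?Z Y) + exp (- (s * ?Z Y)))" by (rule square_le_exp_sum)
    then have "(?Z Y)\<^sup>2 \<le> 2 / s\<^sup>2 * (exp (s * ?Z Y) + exp (- s * ?Z Y))"
      using s0 by (simp add: field_simps power_mult_distrib)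
    then show "ennreal ((?Z Y)\<^sup>2) \<le> ennreal (2 / s\<^sup>2) * (ennreal (exp (s * ?Z Y)) + ennreal (exp (- s * ?Z Y)))"
      by (simp add: ennreal_mult[symmetric] ennreal_plus[symmetric] ennreal_leI del: ennreal_plus)
  qed
  also have "\<dots> = ennreal (2 / s\<^sup>2) * ((\<integral>\<^sup>+Y. ennreal (exp (s * ?Z Y)) \<partial>sample_measure n p A)
      + (\<integral>\<^sup>+Y. ennreal (exp (- s * ?Z Y)) \<partial>sample_measure n p A))"
    using meas by (subst nn_integral_cmult, simp, subst nn_integral_add) auto
  also have "\<dots> \<le> ennreal (2 / s\<^sup>2) * (ennreal (exp (4 * s\<^sup>2 / k\<^sup>2) ^ n) + ennreal (exp (4 * (- s)\<^sup>2 / k\<^sup>2) ^ n))"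
    by (intro mult_left_mono add_mono sample_mgf[OF A pd sp k ab] s) auto
  also have "\<dots> = ennreal (2 / s\<^sup>2 * (2 * exp (4 * s\<^sup>2 / k\<^sup>2) ^ n))"
    by (simp add: ennreal_mult[symmetric] ennreal_plus[symmetric] del: ennreal_plus)
  also have "\<dots> \<le> ennreal (2 / s\<^sup>2 * (2 * 3))"
    using e3 by (intro ennreal_leI mult_left_mono) auto
  also have "2 / s\<^sup>2 * (2 * 3) = real n * (192 / k\<^sup>2)" using k n by (simp add: s2)
  finally show ?thesis .
qed

section \<open>Bounds for the log-determinant and the graphical parametrization\<close>

text \<open>The difference \<open>f\<close> of the two sides has derivative
  \<open>x * (1 / (1 + x) - 1 / (1 + R))\<close>, which has the sign of \<open>x\<close> up to
  \<open>R\<close>; so \<open>f\<close> attains its minimum over this range at zero. The weight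
  \<open>1 / (1 + R)\<close> records how curvature is lost for large perturbations.\<close>

lemma ln_one_plus_le:
  fixes m R :: real
  assumes "-1 < m" "m \<le> R" "0 \<le> R"
  shows "ln (1 + m) \<le> m - m\<^sup>2 / (2 * (1 + R))"
proof -
  define f where "f x = x - x\<^sup>2 / (2 * (1 + R)) - ln (1 + x)" for x :: real
  have D: "(f has_real_derivative x * (1 / (1 + x) - 1 / (1 + R))) (at x)" if "-1 < x" for x
  proof -
    have "(f has_real_derivative 1 - 2 * x / (2 * (1 + R)) - 1 / (1 + x)) (at x)"
      unfolding f_def using that assms(3) by (auto intro!: derivative_eq_intros)
    also have "1 - 2 * x / (2 * (1 + R)) - 1 / (1 + x) = x * (1 / (1 + x) - 1 / (1 + R))"
    proof -
      have "2 * x / (2 * (1 + R)) = x / (1 + R)" by (rule mult_divide_mult_cancel_left) simp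
      moreover have "1 - 1 / (1 + x) = x / (1 + x)" using that by (simp add: field_simps)
      ultimately show ?thesis by (simp add: right_diff_distrib)
    qed
    finally show ?thesis .
  qed
  have "f 0 \<le> f m"
  proof (cases "m \<ge> 0")
    case True
    show ?thesis
    proof (rule DERIV_nonneg_imp_nondecreasing[OF True, of f])
      fix x assume x: "0 \<le> x" "x \<le> m"
      then have "1 / (1 + R) \<le> 1 / (1 + x)" using assms by (intro divide_left_mono) auto
      then show "\<exists>y. (f has_real_derivative y) (at x) \<and> 0 \<le> y"
        using D[of x] x by (intro exI[of _ "x * (1 / (1 + x) - 1 / (1 + R))"]) auto
    qed
  next
    case False
    show ?thesis
    proof (rule DERIV_nonpos_imp_nonincreasing[of m 0 f])
      show "m \<le> 0" using False by simp
      fix x assume x: "m \<le> x" "x \<le> 0"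
      then have "1 / (1 + R) \<le> 1 / (1 + x)" using assms by (intro divide_left_mono) auto
      then show "\<exists>y. (f has_real_derivative y) (at x) \<and> y \<le> 0"
        using D[of x] x assms by (intro exI[of _ "x * (1 / (1 + x) - 1 / (1 + R))"]) (auto simp: mult_nonpos_nonneg)
    qed
  qed
  then show ?thesis by (simp add: f_def)
qed

text \<open>Taking \<open>r\<close> fixed gives a decay that is linear in the distance from \<open>A\<close>, which is what remains
  integrable over all of \<open>P\<^sub>G\<close>.\<close>

lemma det_perturbation_upper:
  assumes sp: "spectral_perturbation n k A S" and k: "k > 0"
    and D: "\<Delta> \<in> carrier_mat n n" "\<Delta>\<^sup>T = \<Delta>" and pd: "pos_def (A + \<Delta>)"
    and r: "0 \<le> r" "r \<le> 1" "r \<le> k * sqrt (frob_sq n \<Delta>)"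
  shows "det (A + \<Delta>) \<le> det A * exp (frob_inner n S \<Delta> - r * k * sqrt (frob_sq n \<Delta>) / 4)"
proof -
  obtain \<mu> where mu: "det (A + \<Delta>) = det A * (\<Prod>i<n. 1 + \<mu> i)" "(\<Sum>i<n. \<mu> i) = frob_inner n S \<Delta>"
    "k\<^sup>2 * frob_sq n \<Delta> \<le> (\<Sum>i<n. (\<mu> i)\<^sup>2)" "pos_def (A + \<Delta>) \<longleftrightarrow> (\<forall>i<n. 1 + \<mu> i > 0)" and dA: "det A > 0"
    using sp D unfolding spectral_perturbation_def by blast
  \<comment> \<open>The Euclidean norm of \<open>\<mu>\<close> bounds each \<open>\<mu> i\<close>
    and its square is the sum of squares, so the total gain is
    \<open>R\<^sup>2 / (2 * (1 + R))\<close>: quadratic for small \<open>R\<close>, linear for large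
    \<open>R\<close>.\<close>
  define R where "R = sqrt (\<Sum>i<n. (\<mu> i)\<^sup>2)"
  have R2: "R\<^sup>2 = (\<Sum>i<n. (\<mu> i)\<^sup>2)" and R0: "R \<ge> 0" unfolding R_def by (simp_all add: sum_nonneg)
  have Rk: "k * sqrt (frob_sq n \<Delta>) \<le> R"
    unfolding R_def using mu(3) k by (intro real_le_rsqrt) (simp add: power_mult_distrib frob_sq_nonneg)
  have mR: "\<mu> i \<le> R" if "i < n" for i
  proof -
    have "(\<mu> i)\<^sup>2 \<le> (\<Sum>i<n. (\<mu> i)\<^sup>2)" using that by (intro member_le_sum) auto
    then show ?thesis unfolding R_def by (rule real_le_rsqrt)
  qed
  have m1: "1 + \<mu> i > 0" if "i < n" for i using pd mu(4) that by blast
  have "(\<Prod>i<n. 1 + \<mu> i) \<le> (\<Prod>i<n. exp (\<mu> i - (\<mu> i)\<^sup>2 / (2 * (1 + R))))"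
  proof (intro prod_mono conjI)
    fix i assume i: "i \<in> {..<n}"
    then show "0 \<le> 1 + \<mu> i" using m1[of i] by simp
    have "ln (1 + \<mu> i) \<le> \<mu> i - (\<mu> i)\<^sup>2 / (2 * (1 + R))"
      using m1[of i] mR[of i] R0 i by (intro ln_one_plus_le) auto
    then show "1 + \<mu> i \<le> exp (\<mu> i - (\<mu> i)\<^sup>2 / (2 * (1 + R)))"
      using m1[of i] i by (metis exp_le_cancel_iff exp_ln lessThan_iff)
  qed
  also have "\<dots> = exp (\<Sum>i<n. \<mu> i - (\<mu> i)\<^sup>2 / (2 * (1 + R)))" by (rule exp_sum[symmetric]) simp
  also have "(\<Sum>i<n. \<mu> i - (\<mu> i)\<^sup>2 / (2 * (1 + R))) = frob_inner n S \<Delta> - R\<^sup>2 / (2 * (1 + R))"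
    by (simp add: sum_subtractf mu(2) R2 sum_divide_distrib)
  also have "\<dots> \<le> frob_inner n S \<Delta> - r * k * sqrt (frob_sq n \<Delta>) / 4"
  proof -
    \<comment> \<open>From \<open>r \<le> 1\<close> and \<open>r \<le> R\<close> follows
      \<open>r / 2 \<le> R / (1 + R)\<close>, which trades the quadratic gain for a linear one with
      slope proportional to \<open>r\<close>.\<close>
    have "r * R \<le> R" using r R0 by (simp add: mult_left_le_one_le)
    then have "r * (1 + R) \<le> 2 * R" using r Rk by (simp add: algebra_simps)
    then have "R * (r * (1 + R)) \<le> R * (2 * R)" using R0 by (intro mult_left_mono) auto
    then have "r * R / 4 \<le> R\<^sup>2 / (2 * (1 + R))" using R0 by (simp add: field_simps power2_eq_square)
    moreover have "r * (k * sqrt (frob_sq n \<Delta>)) \<le> r * R" using Rk r by (intro mult_left_mono) auto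
    ultimately show ?thesis by (simp add: mult.assoc)
  qed
  finally show ?thesis unfolding mu(1) using dA by (intro mult_left_mono) auto
qed

lemma frob_inner_Cauchy_Schwarz: "\<bar>frob_inner n A B\<bar> \<le> sqrt (frob_sq n A) * sqrt (frob_sq n B)"
proof -
  have "(frob_inner n A B)\<^sup>2 \<le> frob_sq n A * frob_sq n B"
    unfolding frob_inner_def frob_sq_def sum.cartesian_product split_def by (rule Cauchy_Schwarz_ineq_sum)
  then have "sqrt ((frob_inner n A B)\<^sup>2) \<le> sqrt (frob_sq n A * frob_sq n B)" by (rule real_sqrt_le_mono)
  then show ?thesis by (simp add: real_sqrt_mult)
qed

lemma frob_inner_add_right:
  assumes "B \<in> carrier_mat n n" "C \<in> carrier_mat n n"
  shows "frob_inner n A (B + C) = frob_inner n A B + frob_inner n A C"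
  unfolding frob_inner_def sum.distrib[symmetric] using assms by (intro sum.cong refl) (auto simp: algebra_simps)

section \<open>Free coordinates and the Frobenius norm\<close>

lemma finite_free_idx: "finite (free_idx p E)"
  by (rule finite_subset[of _ "{..p} \<times> {..p}"]) (auto simp: free_idx_def)

lemma card_free_idx:
  assumes "simple_graph p E"
  shows "card (free_idx p E) = p + num_edges p E"
proof -
  let ?D = "(\<lambda>i. (i,i)) ` {..<p}" and ?F = "{(i, j). i < j \<and> j < p \<and> E i j}"
  have "free_idx p E = ?D \<union> ?F" using assms by (auto simp: free_idx_def simple_graph_def)
  moreover have "finite ?F" by (rule finite_subset[of _ "{..p} \<times> {..p}"]) auto
  moreover have "?D \<inter> ?F = {}" by auto
  moreover have "card ?D = p" by (subst card_image) (auto simp: inj_on_def)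
  ultimately show ?thesis unfolding num_edges_def by (simp add: card_Un_disjoint)
qed

lemma support_free_idx:
  assumes "simple_graph p E"
  shows "{(i,j). i < p \<and> j < p \<and> (i = j \<or> E i j)} = free_idx p E \<union> prod.swap ` free_idx p E"
proof (rule Set.set_eqI)
  fix u :: "nat \<times> nat"
  obtain i j where u: "u = (i,j)" by (cases u)
  have [simp]: "E j i \<longleftrightarrow> E i j" using assms by (auto simp: simple_graph_def)
  have "(i,j) \<in> prod.swap ` free_idx p E \<longleftrightarrow> (j,i) \<in> free_idx p E" by force
  then show "u \<in> {(i,j). i < p \<and> j < p \<and> (i = j \<or> E i j)} \<longleftrightarrow> u \<in> free_idx p E \<union> prod.swap ` free_idx p E"
    unfolding u by (auto simp: free_idx_def)
qed

lemma card_support_le: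
  assumes "simple_graph p E"
  shows "card {(i,j). i < p \<and> j < p \<and> (i = j \<or> E i j)} \<le> 2 * (p + num_edges p E)"
  unfolding support_free_idx[OF assms]
  using card_Un_le[of "free_idx p E" "prod.swap ` free_idx p E"] card_image_le[OF finite_free_idx, of prod.swap p E]
  by (simp add: card_free_idx[OF assms])

lemma M_G_carrier: "A \<in> M_G p E \<Longrightarrow> A \<in> carrier_mat p p" "A \<in> M_G p E \<Longrightarrow> A\<^sup>T = A"
  using sym_mat_transpose[of A p] by (auto simp: M_G_def)

lemma M_G_sym: "A \<in> M_G p E \<Longrightarrow> i < p \<Longrightarrow> j < p \<Longrightarrow> A $$ (i,j) = A $$ (j,i)"
  by (auto simp: M_G_def sym_mat_def)

lemma M_G_I:
  assumes "A \<in> carrier_mat p p" "\<And>i j. i < p \<Longrightarrow> j < p \<Longrightarrow> A $$ (i,j) = A $$ (j,i)"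
    "\<And>i j. i < p \<Longrightarrow> j < p \<Longrightarrow> i \<noteq> j \<Longrightarrow> \<not> E i j \<Longrightarrow> A $$ (i,j) = 0"
  shows "A \<in> M_G p E"
proof -
  have "dim_row A = p" using assms(1) by simp
  then show ?thesis unfolding M_G_def sym_mat_def using assms by simp
qed

lemma to_mat_M_G:
  assumes "simple_graph p E"
  shows "to_mat p E \<theta> \<in> M_G p E"
proof (rule M_G_I)
  fix i j assume ij: "i < p" "j < p"
  then show "to_mat p E \<theta> $$ (i,j) = to_mat p E \<theta> $$ (j,i)"
    by (simp add: to_mat_def min.commute max.commute)
  assume "i \<noteq> j" "\<not> E i j"
  moreover from \<open>\<not> E i j\<close> have "\<not> E j i" using assms by (auto simp: simple_graph_def)
  ultimately have "(min i j, max i j) \<notin> free_idx p E"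
    by (cases "i \<le> j") (auto simp: free_idx_def min_def max_def)
  then show "to_mat p E \<theta> $$ (i,j) = 0" using ij by (simp add: to_mat_def)
qed (simp add: to_mat_def)

lemma M_G_diff:
  assumes A: "A \<in> M_G p E" and B: "B \<in> M_G p E"
  shows "A - B \<in> M_G p E"
proof (rule M_G_I)
  note AB = M_G_carrier(1)[OF A] M_G_carrier(1)[OF B]
  show "A - B \<in> carrier_mat p p" using AB(2) by (rule minus_carrier_mat)
  fix i j assume ij: "i < p" "j < p"
  then show "(A - B) $$ (i,j) = (A - B) $$ (j,i)"
    using AB M_G_sym[OF A ij] M_G_sym[OF B ij] by simp
  assume "i \<noteq> j" "\<not> E i j"
  then show "(A - B) $$ (i,j) = 0" using ij AB A B by (simp add: M_G_def)
qed

lemma to_mat_index: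
  assumes "(i,j) \<in> free_idx p E"
  shows "to_mat p E \<theta> $$ (i,j) = \<theta> (i,j)"
  using assms unfolding to_mat_def free_idx_def by (auto simp: min_absorb1 max_absorb2)

text \<open>A diagonal coordinate fills one entry of the matrix and an off-diagonal one fills two,
  hence the factor between 1 and 2.\<close>

lemma frob_sq_free_idx:
  assumes G: "simple_graph p E" and D: "D \<in> M_G p E"
  shows "(\<Sum>u\<in>free_idx p E. (D $$ u)\<^sup>2) \<le> frob_sq p D" "frob_sq p D \<le> 2 * (\<Sum>u\<in>free_idx p E. (D $$ u)\<^sup>2)"
proof -
  let ?U = "free_idx p E"
  have eq: "frob_sq p D = (\<Sum>u\<in>{..<p}\<times>{..<p}. (D $$ u)\<^sup>2)"
    unfolding frob_sq_def sum.cartesian_product by (simp add: split_def)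
  have sub: "?U \<subseteq> {..<p}\<times>{..<p}" by (auto simp: free_idx_def)
  show "(\<Sum>u\<in>?U. (D $$ u)\<^sup>2) \<le> frob_sq p D"
    unfolding eq using sub by (intro sum_mono2) auto
  have "frob_sq p D = (\<Sum>u\<in>?U \<union> prod.swap ` ?U. (D $$ u)\<^sup>2)"
    unfolding eq support_free_idx[OF G, symmetric]
    by (rule sum.mono_neutral_right) (use D in \<open>auto simp: M_G_def\<close>)
  also have "\<dots> \<le> (\<Sum>u\<in>?U. (D $$ u)\<^sup>2) + (\<Sum>u\<in>prod.swap ` ?U. (D $$ u)\<^sup>2)"
    by (subst sum.union_inter[symmetric]) (auto simp: finite_free_idx sum_nonneg)
  also have "(\<Sum>u\<in>prod.swap ` ?U. (D $$ u)\<^sup>2) = (\<Sum>u\<in>?U. (D $$ (prod.swap u))\<^sup>2)"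
    by (subst sum.reindex) (auto simp: inj_on_def)
  also have "\<dots> = (\<Sum>u\<in>?U. (D $$ u)\<^sup>2)"
    by (rule sum.cong[OF refl]) (use sub M_G_sym[OF D] in auto)
  finally show "frob_sq p D \<le> 2 * (\<Sum>u\<in>?U. (D $$ u)\<^sup>2)" by simp
qed

section \<open>Coordinatewise comparison integrals\<close>

lemma nn_integral_laplace_le:
  fixes c m :: real
  assumes c: "c > 0"
  shows "(\<integral>\<^sup>+t. ennreal (exp (- c * \<bar>t - m\<bar>)) \<partial>lborel) \<le> ennreal (2 / c)"
proof -
  let ?e = "exponential_density c"
  have 1: "(\<integral>\<^sup>+t. ennreal (?e t) \<partial>lborel) = 1"
  proof -
    have "1 = emeasure (density lborel ?e) UNIV"
      using prob_space.emeasure_space_1[OF prob_space_exponential_density[OF c]] by simp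
    then show ?thesis by (simp add: emeasure_density)
  qed
  have s: "(\<integral>\<^sup>+t. ennreal (?e (a + b * t)) \<partial>lborel) = 1" if "\<bar>b\<bar> = 1" for a b :: real
    using nn_integral_real_affine[of "\<lambda>t. ennreal (?e t)" b a] that 1 by force
  \<comment> \<open>Two reflected exponential densities are glued at \<open>m\<close>. They overlap
    at that point, so the integrand is dominated by their sum and not equal to it.\<close>
  have "(\<integral>\<^sup>+t. ennreal (exp (- c * \<bar>t - m\<bar>)) \<partial>lborel)
    \<le> (\<integral>\<^sup>+t. ennreal (1 / c) * (ennreal (?e (- m + 1 * t)) + ennreal (?e (m + (- 1) * t))) \<partial>lborel)"
  proof (rule nn_integral_mono)
    fix t
    have "exp (- c * \<bar>t - m\<bar>) \<le> 1 / c * (?e (- m + 1 * t) + ?e (m + (- 1) * t))"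
    proof (cases "t \<ge> m")
      case True
      then have "exp (- c * \<bar>t - m\<bar>) = 1 / c * ?e (- m + 1 * t)"
        using c by (simp add: exponential_density_def algebra_simps)
      then show ?thesis using c by (simp add: erlang_density_nonneg add_divide_distrib)
    next
      case False
      then have "exp (- c * \<bar>t - m\<bar>) = 1 / c * ?e (m + (- 1) * t)"
        using c by (simp add: exponential_density_def algebra_simps)
      then show ?thesis using c by (simp add: erlang_density_nonneg add_divide_distrib)
    qed
    then show "ennreal (exp (- c * \<bar>t - m\<bar>)) \<le> ennreal (1 / c) * (ennreal (?e (- m + 1 * t)) + ennreal (?e (m + (- 1) * t)))"
      using c by (simp add: ennreal_mult[symmetric] ennreal_plus[symmetric] ennreal_leI erlang_density_nonneg del: ennreal_plus)
  qed
  also have "\<dots> = ennreal (1 / c) * (1 + 1)"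
    by (subst nn_integral_cmult, simp, subst nn_integral_add) (simp_all only: s abs_one abs_minus_cancel, auto)
  also have "\<dots> = ennreal (1 / c) * ennreal 2" by simp
  also have "\<dots> = ennreal (2 / c)" using c by (subst ennreal_mult[symmetric]) auto
  finally show ?thesis .
qed

lemma nn_integral_laplace_product_le:
  fixes c :: real and m :: "'i \<Rightarrow> real"
  assumes c: "c > 0" and I: "finite I"
  shows "(\<integral>\<^sup>+x. ennreal (exp (- c * (\<Sum>i\<in>I. \<bar>x i - m i\<bar>))) \<partial>PiM I (\<lambda>_. lborel)) \<le> ennreal ((2 / c) ^ card I)"
proof -
  interpret product_sigma_finite "\<lambda>_::'i. lborel :: real measure"
    by (simp add: product_sigma_finite_def sigma_finite_lborel)
  have "(\<integral>\<^sup>+x. ennreal (exp (- c * (\<Sum>i\<in>I. \<bar>x i - m i\<bar>))) \<partial>PiM I (\<lambda>_. lborel))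
    = (\<integral>\<^sup>+x. (\<Prod>i\<in>I. ennreal (exp (- c * \<bar>x i - m i\<bar>))) \<partial>PiM I (\<lambda>_. lborel))"
    unfolding sum_distrib_left by (simp only: exp_sum[OF I] prod_ennreal[symmetric] exp_ge_zero)
  also have "\<dots> = (\<Prod>i\<in>I. \<integral>\<^sup>+t. ennreal (exp (- c * \<bar>t - m i\<bar>)) \<partial>lborel)"
    by (rule product_nn_integral_prod[OF I]) simp
  also have "\<dots> \<le> (\<Prod>i\<in>I. ennreal (2 / c))"
    by (intro prod_mono_ennreal nn_integral_laplace_le c)
  also have "\<dots> = ennreal ((2 / c) ^ card I)" using c by (simp add: ennreal_power)
  finally show ?thesis .
qed

lemma nn_integral_cube:
  fixes h :: real and m :: "'i \<Rightarrow> real"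
  assumes h: "h \<ge> 0" and I: "finite I"
  shows "(\<integral>\<^sup>+x. (\<Prod>i\<in>I. indicator {m i - h..m i + h} (x i)) \<partial>PiM I (\<lambda>_. lborel)) = ennreal ((2 * h) ^ card I)"
proof -
  interpret product_sigma_finite "\<lambda>_::'i. lborel :: real measure"
    by (simp add: product_sigma_finite_def sigma_finite_lborel)
  have "(\<integral>\<^sup>+x. (\<Prod>i\<in>I. indicator {m i - h..m i + h} (x i)) \<partial>PiM I (\<lambda>_. lborel))
    = (\<Prod>i\<in>I. \<integral>\<^sup>+t. indicator {m i - h..m i + h} t \<partial>(lborel :: real measure))"
    by (rule product_nn_integral_prod[OF I]) simp
  also have "\<dots> = ennreal ((2 * h) ^ card I)" using h by (simp add: ennreal_power)
  finally show ?thesis .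
qed

section \<open>Score and likelihood\<close>

text \<open>The sample covariance about the known mean zero, without the division by
  \<open>n\<close>.\<close>

definition scatter :: "nat \<Rightarrow> (nat \<Rightarrow> nat \<Rightarrow> real) \<Rightarrow> nat \<Rightarrow> nat \<Rightarrow> real" where
  "scatter n Y i j = (\<Sum>k<n. Y k i * Y k j)"

text \<open>Conjugacy: the data and the prior scale enter through one linear functional of the
  precision matrix. The trace becomes a \<open>frob_inner\<close> because that matrix is
  symmetric.\<close>

lemma likelihood_gw_unnorm:
  assumes P: "to_mat p E \<theta> \<in> P_G p E" and Psi: "\<Psi> \<in> carrier_mat p p"
  shows "likelihood n p (to_mat p E \<theta>) Y * gw_unnorm p E \<delta> \<Psi> \<theta>
    = (2 * pi) powr (- real p * real n / 2) * det (to_mat p E \<theta>) powr ((real n + \<delta>) / 2)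
      * exp (- frob_inner p (mat p p (\<lambda>(i,j). scatter n Y i j + \<Psi> $$ (i,j))) (to_mat p E \<theta>) / 2)"
proof -
  define \<Omega> where "\<Omega> = to_mat p E \<theta>"
  have MG: "\<Omega> \<in> M_G p E" and pd: "pos_def \<Omega>" using P by (auto simp: \<Omega>_def P_G_def)
  note C = M_G_carrier(1)[OF MG]
  have dpos: "det \<Omega> > 0" by (rule nn_integral_gauss(1)[OF C pd])
  have tr: "mtrace (\<Psi> * \<Omega>) = frob_inner p \<Psi> \<Omega>"
  proof -
    have "mtrace (\<Psi> * \<Omega>) = (\<Sum>i<p. \<Sum>j<p. \<Psi> $$ (i,j) * \<Omega> $$ (j,i))"
      unfolding mtrace_def using Psi C by (auto simp: index_mult_sum[of _ p] simp del: index_mult_mat(1) intro!: sum.cong)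
    also have "\<dots> = frob_inner p \<Psi> \<Omega>" unfolding frob_inner_def
    proof (intro sum.cong refl)
      fix i j assume "i \<in> {..<p}" "j \<in> {..<p}"
      then show "\<Psi> $$ (i,j) * \<Omega> $$ (j,i) = \<Psi> $$ (i,j) * \<Omega> $$ (i,j)" using M_G_sym[OF MG, of i j] by simp
    qed
    finally show ?thesis .
  qed
  have quad: "(\<Sum>k<n. \<Sum>i<p. \<Sum>j<p. Y k i * \<Omega> $$ (i,j) * Y k j) = (\<Sum>i<p. \<Sum>j<p. scatter n Y i j * \<Omega> $$ (i,j))"
  proof -
    have "(\<Sum>k<n. \<Sum>i<p. \<Sum>j<p. Y k i * \<Omega> $$ (i,j) * Y k j) = (\<Sum>i<p. \<Sum>k<n. \<Sum>j<p. Y k i * \<Omega> $$ (i,j) * Y k j)"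
      by (rule sum.swap)
    also have "\<dots> = (\<Sum>i<p. \<Sum>j<p. \<Sum>k<n. Y k i * \<Omega> $$ (i,j) * Y k j)"
      by (rule sum.cong[OF refl], rule sum.swap)
    also have "\<dots> = (\<Sum>i<p. \<Sum>j<p. scatter n Y i j * \<Omega> $$ (i,j))"
      unfolding scatter_def sum_distrib_right by (intro sum.cong refl) simp
    finally show ?thesis .
  qed
  have V: "frob_inner p (mat p p (\<lambda>(i,j). scatter n Y i j + \<Psi> $$ (i,j))) \<Omega>
     = (\<Sum>k<n. \<Sum>i<p. \<Sum>j<p. Y k i * \<Omega> $$ (i,j) * Y k j) + mtrace (\<Psi> * \<Omega>)"
    unfolding quad tr unfolding frob_inner_def sum.distrib[symmetric] by (intro sum.cong refl) (simp add: algebra_simps)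
  have "likelihood n p \<Omega> Y = ((2 * pi) powr (- real p / 2) * sqrt (det \<Omega>)) ^ n
      * exp (- (\<Sum>k<n. \<Sum>i<p. \<Sum>j<p. Y k i * \<Omega> $$ (i,j) * Y k j) / 2)"
    unfolding likelihood_def gauss_dens_def
    by (simp add: prod.distrib exp_sum[symmetric] sum_negf[symmetric] sum_divide_distrib[symmetric])
  also have "((2 * pi) powr (- real p / 2) * sqrt (det \<Omega>)) ^ n
      = (2 * pi) powr (- real p * real n / 2) * det \<Omega> powr (real n / 2)"
    using dpos by (simp add: power_mult_distrib powr_half_sqrt[symmetric] powr_power mult.commute)
  finally have L: "likelihood n p \<Omega> Y = (2 * pi) powr (- real p * real n / 2) * det \<Omega> powr (real n / 2)
      * exp (- (\<Sum>k<n. \<Sum>i<p. \<Sum>j<p. Y k i * \<Omega> $$ (i,j) * Y k j) / 2)" .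
  have g: "gw_unnorm p E \<delta> \<Psi> \<theta> = det \<Omega> powr (\<delta> / 2) * exp (- mtrace (\<Psi> * \<Omega>) / 2)"
    using P by (simp add: gw_unnorm_def \<Omega>_def Let_def)
  show ?thesis unfolding \<Omega>_def[symmetric] L g V
    unfolding add_divide_distrib minus_add_distrib powr_add exp_add by (simp only: mult_ac)
qed

text \<open>The left-hand side is \<open>-2\<close> times the derivative at \<open>\<Omega>0\<close> of the log posterior density in
  the direction \<open>\<Delta>\<close>, where \<open>S\<close> is the inverse of \<open>\<Omega>0\<close>.\<close>

lemma score_bound:
  assumes D: "\<Delta> \<in> M_G p E" and Psi: "\<Psi> \<in> carrier_mat p p"
    and S: "S \<in> carrier_mat p p" "frob_sq p S \<le> real p / k\<^sup>2" and k: "k > 0" and \<delta>: "\<delta> > 0"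
    and fPsi: "frob_sq p \<Psi> \<le> real p * a\<^sup>2" and pt: "real p \<le> t"
    and ev: "(\<Sum>(i,j)\<in>{(i,j). i < p \<and> j < p \<and> (i = j \<or> E i j)}. (scatter n Y i j - real n * S $$ (i,j))\<^sup>2) \<le> t"
  shows "\<bar>frob_inner p (mat p p (\<lambda>(i,j). scatter n Y i j + \<Psi> $$ (i,j))) \<Delta> - (real n + \<delta>) * frob_inner p S \<Delta>\<bar>
    \<le> (1 + \<bar>a\<bar> + \<delta> / k) * sqrt t * sqrt (frob_sq p \<Delta>)"
proof -
  let ?F = "{(i,j). i < p \<and> j < p \<and> (i = j \<or> E i j)}"
  \<comment> \<open>\<open>\<Delta>\<close> vanishes off the graph, so the deviation is cut down to
    the free positions before Cauchy-Schwarz is applied. This is where sparsity enters the rate: the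
    norm of \<open>X\<close> has at most \<open>2 d\<close> entries instead of the square of
    \<open>p\<close>.\<close>
  define X where "X = mat p p (\<lambda>(i,j). if i = j \<or> E i j then scatter n Y i j - real n * S $$ (i,j) else 0)"
  have D0: "\<Delta> $$ (i,j) = 0" if "i < p" "j < p" "\<not> (i = j \<or> E i j)" for i j
    using D that by (auto simp: M_G_def)
  have split: "frob_inner p (mat p p (\<lambda>(i,j). scatter n Y i j + \<Psi> $$ (i,j))) \<Delta> - (real n + \<delta>) * frob_inner p S \<Delta>
    = frob_inner p X \<Delta> + frob_inner p \<Psi> \<Delta> - \<delta> * frob_inner p S \<Delta>"
    unfolding frob_inner_def sum_distrib_left sum.distrib[symmetric] sum_subtractf[symmetric]
    by (intro sum.cong refl) (auto simp: X_def D0 algebra_simps)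
  have "frob_sq p X = (\<Sum>(i,j)\<in>{..<p}\<times>{..<p}. (X $$ (i,j))\<^sup>2)"
    unfolding frob_sq_def sum.cartesian_product ..
  also have "\<dots> = (\<Sum>(i,j)\<in>?F. (X $$ (i,j))\<^sup>2)"
    by (rule sum.mono_neutral_right) (auto simp: X_def split: if_splits)
  also have "\<dots> = (\<Sum>(i,j)\<in>?F. (scatter n Y i j - real n * S $$ (i,j))\<^sup>2)"
    by (rule sum.cong) (auto simp: X_def)
  finally have fX: "frob_sq p X \<le> t" using ev by simp
  \<comment> \<open>The contributions of \<open>\<Psi>\<close> and of \<open>\<delta>\<close> have
    norms of order \<open>sqrt p\<close>, so \<open>p \<le> t\<close> lets them be absorbed into the
    noise level \<open>sqrt t\<close>.\<close>
  have pt': "sqrt (real p) \<le> sqrt t" using pt by simp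
  have sX: "sqrt (frob_sq p X) \<le> sqrt t" using fX by simp
  have "sqrt (frob_sq p \<Psi>) \<le> sqrt (real p) * \<bar>a\<bar>" using real_sqrt_le_mono[OF fPsi] by (simp add: real_sqrt_mult)
  also have "\<dots> \<le> sqrt t * \<bar>a\<bar>" using pt' by (intro mult_right_mono) auto
  finally have sPsi: "sqrt (frob_sq p \<Psi>) \<le> \<bar>a\<bar> * sqrt t" by (simp add: mult.commute)
  have "sqrt (frob_sq p S) \<le> sqrt (real p) / k" using real_sqrt_le_mono[OF S(2)] k by (simp add: real_sqrt_divide)
  also have "\<dots> \<le> sqrt t / k" using pt' k by (intro divide_right_mono) auto
  finally have sS: "sqrt (frob_sq p S) \<le> sqrt t / k" .
  let ?d = "sqrt (frob_sq p \<Delta>)"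
  have d0: "?d \<ge> 0" using frob_sq_nonneg by simp
  have 1: "\<bar>frob_inner p X \<Delta>\<bar> \<le> sqrt t * ?d"
    using frob_inner_Cauchy_Schwarz[of p X \<Delta>] mult_right_mono[OF sX d0] by linarith
  have 2: "\<bar>frob_inner p \<Psi> \<Delta>\<bar> \<le> \<bar>a\<bar> * sqrt t * ?d"
    using frob_inner_Cauchy_Schwarz[of p \<Psi> \<Delta>] mult_right_mono[OF sPsi d0] by linarith
  have "\<bar>frob_inner p S \<Delta>\<bar> \<le> sqrt t / k * ?d"
    using frob_inner_Cauchy_Schwarz[of p S \<Delta>] mult_right_mono[OF sS d0] by linarith
  then have "\<delta> * \<bar>frob_inner p S \<Delta>\<bar> \<le> \<delta> * (sqrt t / k * ?d)" using \<delta> by (intro mult_left_mono) auto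
  then have 3: "\<bar>\<delta> * frob_inner p S \<Delta>\<bar> \<le> \<delta> / k * sqrt t * ?d" using \<delta> by (simp add: abs_mult)
  have "(1 + \<bar>a\<bar> + \<delta> / k) * sqrt t * ?d = sqrt t * ?d + \<bar>a\<bar> * sqrt t * ?d + \<delta> / k * sqrt t * ?d"
    by (simp add: algebra_simps)
  then show ?thesis unfolding split using 1 2 3 by linarith
qed

lemma scatter_deviation_measurable:
  assumes "i < p" "j < p"
  shows "(\<lambda>Y. (scatter n Y i j - c)\<^sup>2) \<in> borel_measurable (sample_measure n p A)"
  unfolding scatter_def using assms
  by (intro borel_measurable_power borel_measurable_diff borel_measurable_sum borel_measurable_times
      measurable_sample_component borel_measurable_const) auto

text \<open>Markov's inequality for at most \<open>2 d\<close> squared deviations, each of mean at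
  most \<open>192 * n / k\<^sup>2\<close>. The factors \<open>n\<close> and \<open>d\<close> of the
  threshold cancel, leaving 384 as twice 192 and the reciprocal of \<open>l\<close>.\<close>

lemma scatter_deviation_prob:
  assumes A: "A \<in> carrier_mat p p" and pd: "pos_def A" and G: "simple_graph p E"
    and sp: "spectral_perturbation p k A S" and k: "k > 0" and n: "n > 0" and l: "l > 0" and p: "p > 0"
  defines "B \<equiv> {Y \<in> space (sample_measure n p A). real n * (real (p + num_edges p E) * l)
      < (\<Sum>(i,j)\<in>{(i,j). i < p \<and> j < p \<and> (i = j \<or> E i j)}. (scatter n Y i j - real n * S $$ (i,j))\<^sup>2)}"
  shows "B \<in> sets (sample_measure n p A)" "measure (sample_measure n p A) B \<le> 384 / k\<^sup>2 / l"
proof -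
  let ?F = "{(i,j). i < p \<and> j < p \<and> (i = j \<or> E i j)}"
  let ?M = "sample_measure n p A"
  let ?Z = "\<lambda>Y. \<Sum>(i,j)\<in>?F. (scatter n Y i j - real n * S $$ (i,j))\<^sup>2"
  let ?d = "real (p + num_edges p E)"
  have F: "finite ?F" by (rule finite_subset[of _ "{..p} \<times> {..p}"]) auto
  have mF: "(\<lambda>Y. case u of (i,j) \<Rightarrow> (scatter n Y i j - real n * S $$ (i,j))\<^sup>2) \<in> borel_measurable ?M" if "u \<in> ?F" for u
    using that by (cases u) (auto intro: scatter_deviation_measurable)
  have mZ: "?Z \<in> borel_measurable ?M" by (rule borel_measurable_sum[OF mF])
  show B: "B \<in> sets ?M" unfolding B_def using mZ by measurable
  define c where "c = real n * (?d * l)"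
  have c: "c > 0" using n l p by (simp add: c_def add_pos_nonneg)
  have "(\<integral>\<^sup>+Y. ennreal (?Z Y) \<partial>?M) = (\<Sum>u\<in>?F. \<integral>\<^sup>+Y. ennreal (case u of (i,j) \<Rightarrow> (scatter n Y i j - real n * S $$ (i,j))\<^sup>2) \<partial>?M)"
    by (subst nn_integral_sum[symmetric])
       (auto simp: mF sum_ennreal[symmetric] split_def simp del: sum_ennreal intro!: scatter_deviation_measurable sum_ennreal)
  also have "\<dots> \<le> (\<Sum>u\<in>?F. ennreal (real n * (192 / k\<^sup>2)))"
  proof (rule sum_mono)
    fix u assume "u \<in> ?F"
    then obtain i j where u: "u = (i,j)" "i < p" "j < p" by auto
    have "scatter n Y i j - real n * S $$ (i,j) = (\<Sum>k<n. Y k i * Y k j - S $$ (i,j))" for Y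
      by (simp add: scatter_def sum_subtractf)
    then show "(\<integral>\<^sup>+Y. ennreal (case u of (i,j) \<Rightarrow> (scatter n Y i j - real n * S $$ (i,j))\<^sup>2) \<partial>?M)
        \<le> ennreal (real n * (192 / k\<^sup>2))"
      using sample_second_moment[OF A pd sp k u(2,3) n] by (simp add: u(1))
  qed
  also have "\<dots> = ennreal (real (card ?F) * (real n * (192 / k\<^sup>2)))"
    by (subst sum_constant, subst ennreal_of_nat_eq_real_of_nat, rule ennreal_mult[symmetric]) auto
  also have "\<dots> \<le> ennreal (2 * ?d * (real n * (192 / k\<^sup>2)))"
  proof (intro ennreal_leI mult_right_mono)
    show "real (card ?F) \<le> 2 * ?d"
      using of_nat_mono[OF card_support_le[OF G]] by (simp only: of_nat_mult of_nat_numeral)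
  qed simp
  finally have EZ: "(\<integral>\<^sup>+Y. ennreal (?Z Y) \<partial>?M) \<le> ennreal (2 * ?d * (real n * (192 / k\<^sup>2)))" .
  have "emeasure ?M B = (\<integral>\<^sup>+Y. indicator B Y \<partial>?M)" using B by simp
  also have "\<dots> \<le> (\<integral>\<^sup>+Y. ennreal (1 / c) * ennreal (?Z Y) \<partial>?M)"
  proof (rule nn_integral_mono)
    fix Y
    have Z0: "?Z Y \<ge> 0" by (intro sum_nonneg) auto
    have "1 \<le> 1 / c * ?Z Y" if "Y \<in> B" using that c unfolding B_def c_def[symmetric] by (simp add: field_simps)
    then show "indicator B Y \<le> ennreal (1 / c) * ennreal (?Z Y)"
      using c Z0 by (auto simp: indicator_def ennreal_mult[symmetric])
  qed
  also have "\<dots> = ennreal (1 / c) * (\<integral>\<^sup>+Y. ennreal (?Z Y) \<partial>?M)" using mZ by (intro nn_integral_cmult) auto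
  also have "\<dots> \<le> ennreal (1 / c) * ennreal (2 * ?d * (real n * (192 / k\<^sup>2)))" by (intro mult_left_mono EZ) simp
  also have "\<dots> = ennreal (1 / c * (2 * ?d * (real n * (192 / k\<^sup>2))))" using c by (intro ennreal_mult[symmetric]) auto
  also have "1 / c * (2 * ?d * (real n * (192 / k\<^sup>2))) = 384 / k\<^sup>2 / l"
  proof -
    have "1 / (N * (D * L)) * (2 * D * (N * (192 / K))) = 384 / K / L"
      if "N > 0" "D > 0" "L > 0" "K > 0" for N D L K :: real
      using that by (simp add: field_simps)
    from this[of "real n" ?d l "k\<^sup>2"] show ?thesis using n p k l by (simp add: c_def add_pos_nonneg)
  qed
  finally have "emeasure ?M B \<le> ennreal (384 / k\<^sup>2 / l)" .
  then show "measure ?M B \<le> 384 / k\<^sup>2 / l" unfolding measure_def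
    using l k by (intro enn2real_leI) auto
qed

text \<open>The two passages between matrix and coordinates. By Cauchy-Schwarz the sum of absolute
  values is at most \<open>sqrt d\<close> times the norm, which makes exponential decay in the norm
  integrable coordinate by coordinate. Conversely a cube of half-width \<open>h\<close> lies in a
  ball of radius \<open>sqrt (2 * d) * h\<close>.\<close>

lemma to_mat_deviation:
  assumes G: "simple_graph p E" and \<Omega>0: "\<Omega>0 \<in> M_G p E" and d: "d = real (p + num_edges p E)" "d > 0"
  defines "\<Delta> \<equiv> (\<lambda>\<theta>. to_mat p E \<theta> - \<Omega>0)"
  shows "(\<Sum>u\<in>free_idx p E. \<bar>\<theta> u - \<Omega>0 $$ u\<bar>) / sqrt d \<le> sqrt (frob_sq p (\<Delta> \<theta>))"
    and "(\<And>u. u \<in> free_idx p E \<Longrightarrow> \<bar>\<theta> u - \<Omega>0 $$ u\<bar> \<le> h) \<Longrightarrow> frob_sq p (\<Delta> \<theta>) \<le> 2 * d * h\<^sup>2"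
proof -
  let ?U = "free_idx p E"
  have MG: "\<Delta> \<theta> \<in> M_G p E" unfolding \<Delta>_def by (intro M_G_diff to_mat_M_G G \<Omega>0)
  have idx: "\<Delta> \<theta> $$ u = \<theta> u - \<Omega>0 $$ u" if "u \<in> ?U" for u
    using that M_G_carrier(1)[OF \<Omega>0] M_G_carrier(1)[OF to_mat_M_G[OF G, of \<theta>]] to_mat_index[of "fst u" "snd u" p E \<theta>]
    unfolding \<Delta>_def by (cases u) (auto simp: free_idx_def)
  have eq: "(\<Sum>u\<in>?U. (\<Delta> \<theta> $$ u)\<^sup>2) = (\<Sum>u\<in>?U. \<bar>\<theta> u - \<Omega>0 $$ u\<bar>\<^sup>2)"
    by (rule sum.cong) (auto simp: idx)
  have card: "real (card ?U) = d" using card_free_idx[OF G] d by simp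
  have "(\<Sum>u\<in>?U. \<bar>\<theta> u - \<Omega>0 $$ u\<bar>)\<^sup>2 \<le> (\<Sum>u\<in>?U. \<bar>\<theta> u - \<Omega>0 $$ u\<bar>\<^sup>2) * d"
    using sum_squared_le_sum_of_squares[of "\<lambda>u. \<bar>\<theta> u - \<Omega>0 $$ u\<bar>" ?U] unfolding card .
  also have "\<dots> \<le> frob_sq p (\<Delta> \<theta>) * d"
    using frob_sq_free_idx(1)[OF G MG] d unfolding eq by (intro mult_right_mono) auto
  finally have "(\<Sum>u\<in>?U. \<bar>\<theta> u - \<Omega>0 $$ u\<bar>) \<le> sqrt (frob_sq p (\<Delta> \<theta>) * d)" by (rule real_le_rsqrt)
  then show "(\<Sum>u\<in>?U. \<bar>\<theta> u - \<Omega>0 $$ u\<bar>) / sqrt d \<le> sqrt (frob_sq p (\<Delta> \<theta>))"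
    using d by (simp add: real_sqrt_mult divide_le_eq)
  assume h: "\<And>u. u \<in> ?U \<Longrightarrow> \<bar>\<theta> u - \<Omega>0 $$ u\<bar> \<le> h"
  have "(\<Sum>u\<in>?U. \<bar>\<theta> u - \<Omega>0 $$ u\<bar>\<^sup>2) \<le> (\<Sum>u\<in>?U. h\<^sup>2)"
    by (intro sum_mono power_mono h) auto
  then show "frob_sq p (\<Delta> \<theta>) \<le> 2 * d * h\<^sup>2"
    using frob_sq_free_idx(2)[OF G MG] unfolding eq by (simp add: card)
qed

section \<open>Posterior contraction\<close>

text \<open>Numerator and denominator are compared with products of one-dimensional integrals: the
  numerator is dominated by a product of Laplace densities, the denominator is bounded below by its
  part over a cube around \<open>\<Omega>0\<close>. Since only these bounds are integrated, the measurability of \<open>P\<^sub>G\<close>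
  plays no role.\<close>

lemma posterior_tail_bound:
  fixes \<Omega>0 \<Psi> S :: "real mat" and \<epsilon> k C M l \<delta> d :: real
  assumes G: "simple_graph p E" and O: "\<Omega>0 \<in> P_G p E" and Psi: "\<Psi> \<in> carrier_mat p p"
    and sp: "spectral_perturbation p k \<Omega>0 S" and k: "0 < k"
    and n: "n > 0" and \<delta>: "0 < \<delta>" "\<delta> \<le> real n" and p: "p > 0"
    and d: "d = real (p + num_edges p E)" and \<epsilon>: "\<epsilon> > 0" "real n * \<epsilon>\<^sup>2 = d * l" and l: "l \<ge> 1"
    and score: "\<And>\<Delta>. \<Delta> \<in> M_G p E \<Longrightarrow>
      \<bar>frob_inner p (mat p p (\<lambda>(i,j). scatter n Y i j + \<Psi> $$ (i,j))) \<Delta> - (real n + \<delta>) * frob_inner p S \<Delta>\<bar>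
        \<le> C * (real n * \<epsilon>) * sqrt (frob_sq p \<Delta>)"
    and C: "C \<ge> 0" and M: "8 * C \<le> k\<^sup>2 * M" "64 \<le> k\<^sup>2 * M" "2 / k\<^sup>2 + C / 2 + 1 \<le> M"
    and small: "k * (M * \<epsilon>) \<le> 1"
  shows "posterior n p E \<delta> \<Psi> Y
     {\<theta> \<in> space (param_space p E). M * \<epsilon> < frob_norm (to_mat p E \<theta> - \<Omega>0)} \<le> exp (- l)"
proof -
  let ?U = "free_idx p E"
  let ?P = "param_space p E"
  let ?A = "{\<theta> \<in> space ?P. M * \<epsilon> < frob_norm (to_mat p E \<theta> - \<Omega>0)}"
  define V where "V = mat p p (\<lambda>(i,j). scatter n Y i j + \<Psi> $$ (i,j))"
  define \<Delta> where "\<Delta> \<theta> = to_mat p E \<theta> - \<Omega>0" for \<theta>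
  \<comment> \<open>The posterior kernel at \<open>\<Omega>0\<close>. Both estimates are made
    relative to it, so it cancels in the quotient.\<close>
  define K where "K = (2 * pi) powr (- real p * real n / 2) * det \<Omega>0 powr ((real n + \<delta>) / 2) * exp (- frob_inner p V \<Omega>0 / 2)"
  define Lg where "Lg \<theta> = likelihood n p (to_mat p E \<theta>) Y * gw_unnorm p E \<delta> \<Psi> \<theta>" for \<theta>
  define N where "N \<theta> = sqrt (frob_sq p (\<Delta> \<theta>))" for \<theta>
  define T where "T \<theta> = (\<Sum>u\<in>?U. \<bar>\<theta> u - \<Omega>0 $$ u\<bar>)" for \<theta> :: "nat \<times> nat \<Rightarrow> real"
  \<comment> \<open>The determinant bound yields a decay of at least
    \<open>n \<epsilon> k\<^sup>2 M / 8\<close> per unit of norm, and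
    \<open>8 * C \<le> k\<^sup>2 * M\<close> lets the linear term use up at most half of it. What
    remains is \<open>2 * \<beta>\<close>: one \<open>\<beta>\<close> becomes the factor at the
    boundary of the ball, the other keeps the tail integrable.\<close>
  define \<beta> where "\<beta> = real n * \<epsilon> * k\<^sup>2 * M / 32"
  \<comment> \<open>Chosen so that \<open>2 * d * h\<^sup>2 = \<epsilon>\<^sup>2 / 2\<close>, which
    places the cube inside the ball of radius \<open>\<epsilon>\<close>.\<close>
  define h where "h = \<epsilon> / (2 * sqrt d)"
  have OM: "\<Omega>0 \<in> M_G p E" and Opd: "pos_def \<Omega>0" using O by (auto simp: P_G_def)
  have OC: "\<Omega>0 \<in> carrier_mat p p" by (rule M_G_carrier(1)[OF OM])
  have detO: "det \<Omega>0 > 0" by (rule nn_integral_gauss(1)[OF OC Opd])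
  have K0: "K > 0" using detO by (simp add: K_def)
  have d1: "d \<ge> 1" using p d by simp
  have M0: "M > 0" using k M(2) by (metis less_le_trans zero_less_mult_pos zero_less_numeral zero_less_power)
  have \<beta>0: "\<beta> > 0" using n \<epsilon> k M0 by (simp add: \<beta>_def)
  have h0: "h > 0" using \<epsilon> d1 by (simp add: h_def)
  have DM: "\<Delta> \<theta> \<in> M_G p E" for \<theta> unfolding \<Delta>_def by (intro M_G_diff to_mat_M_G G OM)
  note DC = M_G_carrier(1)[OF DM] and DT = M_G_carrier(2)[OF DM]
  have OD: "\<Omega>0 + \<Delta> \<theta> = to_mat p E \<theta>" for \<theta>
    unfolding \<Delta>_def using OC M_G_carrier(1)[OF to_mat_M_G[OF G, of \<theta>]] by (intro eq_matI) auto
  have frob: "frob_norm (to_mat p E \<theta> - \<Omega>0) = N \<theta>" for \<theta>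
    unfolding N_def \<Delta>_def[symmetric] by (rule frob_norm_frob_sq[OF DC])
  have N0: "N \<theta> \<ge> 0" for \<theta> unfolding N_def using frob_sq_nonneg by simp
  have N2: "frob_sq p (\<Delta> \<theta>) = (N \<theta>)\<^sup>2" for \<theta> unfolding N_def using frob_sq_nonneg by simp
  have TN: "T \<theta> / sqrt d \<le> N \<theta>" for \<theta>
    using to_mat_deviation(1)[OF G OM d] d1 unfolding T_def N_def \<Delta>_def by simp
  have score': "\<bar>frob_inner p V (\<Delta> \<theta>) - (real n + \<delta>) * frob_inner p S (\<Delta> \<theta>)\<bar> \<le> C * (real n * \<epsilon>) * N \<theta>" for \<theta>
    using score[OF DM] unfolding V_def N_def .
  have Lg_eq: "Lg \<theta> = (2 * pi) powr (- real p * real n / 2) * det (\<Omega>0 + \<Delta> \<theta>) powr ((real n + \<delta>) / 2)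
      * exp (- frob_inner p V \<Omega>0 / 2 - frob_inner p V (\<Delta> \<theta>) / 2)" if "to_mat p E \<theta> \<in> P_G p E" for \<theta>
  proof -
    have "frob_inner p V (to_mat p E \<theta>) = frob_inner p V \<Omega>0 + frob_inner p V (\<Delta> \<theta>)"
      unfolding OD[symmetric] by (rule frob_inner_add_right[OF OC DC])
    then show ?thesis unfolding Lg_def OD
      by (subst likelihood_gw_unnorm[OF that Psi]) (simp add: V_def[symmetric] diff_divide_distrib add_divide_distrib)
  qed
  have factor: "(2 * pi) powr (- real p * real n / 2) * (det \<Omega>0 * exp x) powr ((real n + \<delta>) / 2)
      * exp (- frob_inner p V \<Omega>0 / 2 - y / 2) = K * exp ((real n + \<delta>) / 2 * x - y / 2)" for x y
  proof -
    have "(det \<Omega>0 * exp x) powr ((real n + \<delta>) / 2) = det \<Omega>0 powr ((real n + \<delta>) / 2) * exp ((real n + \<delta>) / 2 * x)"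
      using detO by (simp add: powr_mult exp_powr_real mult.commute)
    then show ?thesis
      unfolding K_def diff_conv_add_uminus[of _ "y / 2"] exp_add by (simp only: mult_ac)
  qed
  have pd_iff: "to_mat p E \<theta> \<in> P_G p E \<longleftrightarrow> pos_def (\<Omega>0 + \<Delta> \<theta>)" for \<theta>
    unfolding OD P_G_def using to_mat_M_G[OF G] by simp

  have upper: "Lg \<theta> \<le> K * (exp (- \<beta> * (M * \<epsilon>)) * exp (- (\<beta> / sqrt d) * T \<theta>))"
    if far: "M * \<epsilon> < N \<theta>" for \<theta>
  proof (cases "to_mat p E \<theta> \<in> P_G p E")
    case False
    then have "Lg \<theta> = 0" by (simp add: Lg_def gw_unnorm_def)
    then show ?thesis using K0 by simp
  next
    case True
    have pd: "pos_def (\<Omega>0 + \<Delta> \<theta>)" using True pd_iff by simp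
    have dpos: "det (\<Omega>0 + \<Delta> \<theta>) > 0"
      using nn_integral_gauss(1)[OF _ pd, of p] OC DC by simp
    \<comment> \<open>Here \<open>r = k * (M * \<epsilon>)\<close>, the common lower bound of
      \<open>k * N \<theta>\<close> outside the ball; \<open>small\<close> keeps it at most
      1.\<close>
    have "det (\<Omega>0 + \<Delta> \<theta>) \<le> det \<Omega>0 * exp (frob_inner p S (\<Delta> \<theta>) - k * (M * \<epsilon>) * k * sqrt (frob_sq p (\<Delta> \<theta>)) / 4)"
    proof (rule det_perturbation_upper[OF sp k DC DT pd _ small])
      show "0 \<le> k * (M * \<epsilon>)" using k M0 \<epsilon> by simp
      show "k * (M * \<epsilon>) \<le> k * sqrt (frob_sq p (\<Delta> \<theta>))" using far k unfolding N_def by simp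
    qed
    then have det: "det (\<Omega>0 + \<Delta> \<theta>) \<le> det \<Omega>0 * exp (frob_inner p S (\<Delta> \<theta>) - k\<^sup>2 * M * \<epsilon> * N \<theta> / 4)"
      unfolding N_def by (simp add: power2_eq_square mult_ac)
    have "Lg \<theta> \<le> (2 * pi) powr (- real p * real n / 2) *
        (det \<Omega>0 * exp (frob_inner p S (\<Delta> \<theta>) - k\<^sup>2 * M * \<epsilon> * N \<theta> / 4)) powr ((real n + \<delta>) / 2)
        * exp (- frob_inner p V \<Omega>0 / 2 - frob_inner p V (\<Delta> \<theta>) / 2)"
      unfolding Lg_eq[OF True] using det dpos \<delta>
      by (intro mult_right_mono mult_left_mono powr_mono2) auto
    also have "\<dots> = K * exp ((real n + \<delta>) / 2 * (frob_inner p S (\<Delta> \<theta>) - k\<^sup>2 * M * \<epsilon> * N \<theta> / 4) - frob_inner p V (\<Delta> \<theta>) / 2)"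
      by (rule factor)
    also have "\<dots> \<le> K * exp (- \<beta> * (M * \<epsilon>) + - (\<beta> / sqrt d) * T \<theta>)"
    proof -
      \<comment> \<open>\<open>X\<close> is the linear term, \<open>c\<close> its bound,
        \<open>q\<close> the curvature gain, and \<open>s\<close> the extra gain from
        \<open>\<delta>\<close>, which is discarded.\<close>
      have arith: "A \<le> - b"
        if "- X \<le> c" "c \<le> q" "0 \<le> s" "A = - X / 2 - q - s / 8" "b = q / 2" for A X q s b c :: real
        using that by linarith
      have "- (frob_inner p V (\<Delta> \<theta>) - (real n + \<delta>) * frob_inner p S (\<Delta> \<theta>)) \<le> C * (real n * \<epsilon> * N \<theta>)"
        using score'[of \<theta>] by (simp add: abs_le_iff mult.assoc)
      moreover have "C * (real n * \<epsilon> * N \<theta>) \<le> k\<^sup>2 * M / 8 * (real n * \<epsilon> * N \<theta>)"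
        using M(1) \<epsilon> N0 by (intro mult_right_mono) auto
      moreover have "0 \<le> \<delta> * (k\<^sup>2 * M * \<epsilon> * N \<theta>)" using \<delta> M0 \<epsilon> N0[of \<theta>] by simp
      moreover have "(real n + \<delta>) / 2 * (frob_inner p S (\<Delta> \<theta>) - k\<^sup>2 * M * \<epsilon> * N \<theta> / 4) - frob_inner p V (\<Delta> \<theta>) / 2
        = - (frob_inner p V (\<Delta> \<theta>) - (real n + \<delta>) * frob_inner p S (\<Delta> \<theta>)) / 2
           - k\<^sup>2 * M / 8 * (real n * \<epsilon> * N \<theta>) - \<delta> * (k\<^sup>2 * M * \<epsilon> * N \<theta>) / 8"
        by (simp add: field_simps)
      moreover have "2 * \<beta> * N \<theta> = k\<^sup>2 * M / 8 * (real n * \<epsilon> * N \<theta>) / 2" by (simp add: \<beta>_def)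
      ultimately have "(real n + \<delta>) / 2 * (frob_inner p S (\<Delta> \<theta>) - k\<^sup>2 * M * \<epsilon> * N \<theta> / 4) - frob_inner p V (\<Delta> \<theta>) / 2
        \<le> - (2 * \<beta> * N \<theta>)" by (rule arith)
      also have "\<dots> \<le> - \<beta> * (M * \<epsilon>) + - (\<beta> / sqrt d) * T \<theta>"
      proof -
        have "\<beta> * (M * \<epsilon>) \<le> \<beta> * N \<theta>" using far \<beta>0 by (intro mult_left_mono) auto
        moreover have "\<beta> * (T \<theta> / sqrt d) \<le> \<beta> * N \<theta>" using TN \<beta>0 by (intro mult_left_mono) auto
        moreover have "\<beta> * (T \<theta> / sqrt d) = \<beta> / sqrt d * T \<theta>" by simp
        ultimately show ?thesis by linarith
      qed
      finally show ?thesis using K0 by simp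
    qed
    finally show ?thesis unfolding exp_add .
  qed

  \<comment> \<open>The loss inside the cube: \<open>2 / k\<^sup>2\<close> comes from the quadratic
    term together with \<open>n + \<delta> \<le> 2 * n\<close>, and \<open>C / 2\<close> from the
    linear term at distance at most \<open>\<epsilon>\<close>.\<close>
  have lower: "K * exp (- (2 / k\<^sup>2 + C / 2) * (d * l)) \<le> Lg \<theta>"
    if near: "\<And>u. u \<in> ?U \<Longrightarrow> \<bar>\<theta> u - \<Omega>0 $$ u\<bar> \<le> h" for \<theta>
  proof -
    have "frob_sq p (\<Delta> \<theta>) \<le> 2 * d * h\<^sup>2"
      using to_mat_deviation(2)[OF G OM d _ near] d1 unfolding \<Delta>_def by simp
    also have "\<dots> = \<epsilon>\<^sup>2 / 2" using d1 by (simp add: h_def power_divide power_mult_distrib)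
    also have "\<dots> \<le> \<epsilon>\<^sup>2" by simp
    finally have f\<epsilon>: "frob_sq p (\<Delta> \<theta>) \<le> \<epsilon>\<^sup>2" .
    then have N\<epsilon>: "N \<theta> \<le> \<epsilon>" using \<epsilon>(1) N2 by (metis less_imp_le power2_le_imp_le)
    \<comment> \<open>That \<open>\<epsilon>\<close> is small compared with \<open>k\<close> follows
      from \<open>small\<close> and the lower bound on \<open>M\<close>.\<close>
    have "k\<^sup>2 * M * \<epsilon> \<le> k" using small k by (simp add: power2_eq_square mult.assoc)
    moreover have "64 * \<epsilon> \<le> k\<^sup>2 * M * \<epsilon>" using M(2) \<epsilon>(1) by (intro mult_right_mono) auto
    ultimately have "\<epsilon> \<le> k / 2" using k by linarith
    then have "\<epsilon>\<^sup>2 \<le> (k / 2)\<^sup>2" using \<epsilon>(1) by (intro power_mono) auto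
    then have "frob_sq p (\<Delta> \<theta>) \<le> k\<^sup>2 / 4" using f\<epsilon> by (simp add: power_divide)
    note dl = det_perturbation_lower[OF OC sp k DC DT this]
    have True': "to_mat p E \<theta> \<in> P_G p E" using dl(1) pd_iff by simp
    have "K * exp (- (2 / k\<^sup>2 + C / 2) * (d * l))
      \<le> K * exp ((real n + \<delta>) / 2 * (frob_inner p S (\<Delta> \<theta>) - 2 * frob_sq p (\<Delta> \<theta>) / k\<^sup>2) - frob_inner p V (\<Delta> \<theta>) / 2)"
    proof -
      have arith: "B \<le> A" if "A = - X / 2 - w" "B = - c / 2 - v" "X \<le> c" "w \<le> v" for A B X w c v :: real
        using that by linarith
      have "frob_inner p V (\<Delta> \<theta>) - (real n + \<delta>) * frob_inner p S (\<Delta> \<theta>) \<le> C * (real n * \<epsilon>) * N \<theta>"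
        using score'[of \<theta>] by linarith
      also have "\<dots> \<le> C * (real n * \<epsilon>) * \<epsilon>" using N\<epsilon> C \<epsilon>(1) by (intro mult_left_mono) auto
      also have "\<dots> = C * (d * l)" unfolding \<epsilon>(2)[symmetric] by (simp add: power2_eq_square mult_ac)
      finally have 1: "frob_inner p V (\<Delta> \<theta>) - (real n + \<delta>) * frob_inner p S (\<Delta> \<theta>) \<le> C * (d * l)" .
      have "(real n + \<delta>) * (frob_sq p (\<Delta> \<theta>) / k\<^sup>2) \<le> (2 * real n) * (\<epsilon>\<^sup>2 / k\<^sup>2)"
        using \<delta> f\<epsilon> k frob_sq_nonneg by (intro mult_mono divide_right_mono) auto
      also have "\<dots> = 2 / k\<^sup>2 * (d * l)" unfolding \<epsilon>(2)[symmetric] by simp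
      finally have 2: "(real n + \<delta>) * (frob_sq p (\<Delta> \<theta>) / k\<^sup>2) \<le> 2 / k\<^sup>2 * (d * l)" .
      have "(real n + \<delta>) / 2 * (frob_inner p S (\<Delta> \<theta>) - 2 * frob_sq p (\<Delta> \<theta>) / k\<^sup>2) - frob_inner p V (\<Delta> \<theta>) / 2
        = - (frob_inner p V (\<Delta> \<theta>) - (real n + \<delta>) * frob_inner p S (\<Delta> \<theta>)) / 2 - (real n + \<delta>) * (frob_sq p (\<Delta> \<theta>) / k\<^sup>2)"
        by (simp add: algebra_simps add_divide_distrib diff_divide_distrib)
      moreover have "- (2 / k\<^sup>2 + C / 2) * (d * l) = - (C * (d * l)) / 2 - 2 / k\<^sup>2 * (d * l)" by (simp add: algebra_simps)
      ultimately have "- (2 / k\<^sup>2 + C / 2) * (d * l) \<le> (real n + \<delta>) / 2 * (frob_inner p S (\<Delta> \<theta>) - 2 * frob_sq p (\<Delta> \<theta>) / k\<^sup>2) - frob_inner p V (\<Delta> \<theta>) / 2"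
        using arith 1 2 by blast
      then show ?thesis using K0 by simp
    qed
    also have "\<dots> = (2 * pi) powr (- real p * real n / 2) *
        (det \<Omega>0 * exp (frob_inner p S (\<Delta> \<theta>) - 2 * frob_sq p (\<Delta> \<theta>) / k\<^sup>2)) powr ((real n + \<delta>) / 2)
        * exp (- frob_inner p V \<Omega>0 / 2 - frob_inner p V (\<Delta> \<theta>) / 2)"
      by (rule factor[symmetric])
    also have "\<dots> \<le> Lg \<theta>"
      unfolding Lg_eq[OF True'] using dl(2) detO \<delta>
      by (intro mult_right_mono mult_left_mono powr_mono2) auto
    finally show ?thesis .
  qed

  \<comment> \<open>The reciprocal of the prior normalizing constant, carried as an extended
    non-negative factor common to numerator and denominator.\<close>
  define c where "c = inverse (\<integral>\<^sup>+ t. ennreal (gw_unnorm p E \<delta> \<Psi> t) \<partial>?P)"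
  have lik0: "likelihood n p (to_mat p E \<theta>) Y \<ge> 0" if "to_mat p E \<theta> \<in> P_G p E" for \<theta>
    unfolding likelihood_def gauss_dens_def using that nn_integral_gauss(1)[of "to_mat p E \<theta>" p] M_G_carrier(1)
    by (intro prod_nonneg) (auto simp: P_G_def less_imp_le)
  have dens: "ennreal (likelihood n p (to_mat p E \<theta>) Y) * gw_density p E \<delta> \<Psi> \<theta> = c * ennreal (Lg \<theta>)" for \<theta>
  proof (cases "to_mat p E \<theta> \<in> P_G p E")
    case True
    have "gw_unnorm p E \<delta> \<Psi> \<theta> \<ge> 0" using True by (simp add: gw_unnorm_def Let_def)
    then show ?thesis using lik0[OF True]
      by (simp add: gw_density_def Lg_def c_def divide_ennreal_def ennreal_mult mult_ac)
  next
    case False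
    then have "gw_unnorm p E \<delta> \<Psi> \<theta> = 0" by (simp add: gw_unnorm_def Let_def)
    then show ?thesis by (simp add: gw_density_def Lg_def divide_ennreal_def)
  qed
  let ?num = "\<integral>\<^sup>+ \<theta>. indicator ?A \<theta> * ennreal (likelihood n p (to_mat p E \<theta>) Y) * gw_density p E \<delta> \<Psi> \<theta> \<partial>?P"
  let ?den = "\<integral>\<^sup>+ \<theta>. ennreal (likelihood n p (to_mat p E \<theta>) Y) * gw_density p E \<delta> \<Psi> \<theta> \<partial>?P"
  let ?a = "exp (- \<beta> * (M * \<epsilon>))" and ?b = "exp (- (2 / k\<^sup>2 + C / 2) * (d * l))"
  have meas: "(\<lambda>\<theta>. ennreal (exp (- (\<beta> / sqrt d) * T \<theta>))) \<in> borel_measurable ?P"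
  proof -
    have "(\<lambda>\<theta>. \<bar>\<theta> u - \<Omega>0 $$ u\<bar>) \<in> borel_measurable ?P" if "u \<in> ?U" for u
    proof -
      have [measurable]: "(\<lambda>\<theta>. \<theta> u) \<in> borel_measurable ?P"
        unfolding param_space_def by (rule measurable_lborel_component[OF that])
      show ?thesis by measurable
    qed
    then have [measurable]: "T \<in> borel_measurable ?P"
      unfolding T_def by (rule borel_measurable_sum)
    show ?thesis by measurable
  qed
  have "?num \<le> (\<integral>\<^sup>+ \<theta>. (c * ennreal (K * ?a)) * ennreal (exp (- (\<beta> / sqrt d) * T \<theta>)) \<partial>?P)"
  proof (rule nn_integral_mono)
    fix \<theta>
    show "indicator ?A \<theta> * ennreal (likelihood n p (to_mat p E \<theta>) Y) * gw_density p E \<delta> \<Psi> \<theta>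
      \<le> (c * ennreal (K * ?a)) * ennreal (exp (- (\<beta> / sqrt d) * T \<theta>))"
    proof (cases "\<theta> \<in> ?A")
      case True
      then have "M * \<epsilon> < N \<theta>" using frob by simp
      then have "c * ennreal (Lg \<theta>) \<le> c * ennreal (K * (?a * exp (- (\<beta> / sqrt d) * T \<theta>)))"
        by (intro mult_left_mono ennreal_leI upper) auto
      also have "\<dots> = (c * ennreal (K * ?a)) * ennreal (exp (- (\<beta> / sqrt d) * T \<theta>))"
        using K0 by (simp add: ennreal_mult mult.assoc)
      finally show ?thesis using True dens[of \<theta>] by simp
    qed simp
  qed
  also have "\<dots> = (c * ennreal (K * ?a)) * (\<integral>\<^sup>+ \<theta>. ennreal (exp (- (\<beta> / sqrt d) * T \<theta>)) \<partial>?P)"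
    by (rule nn_integral_cmult[OF meas])
  also have "\<dots> \<le> (c * ennreal (K * ?a)) * ennreal ((2 / (\<beta> / sqrt d)) ^ card ?U)"
    unfolding T_def param_space_def using \<beta>0 d1
    by (intro mult_left_mono nn_integral_laplace_product_le finite_free_idx) auto
  also have "\<dots> = c * ennreal (K * (?a * (2 / (\<beta> / sqrt d)) ^ card ?U))"
    using K0 \<beta>0 d1 by (simp add: ennreal_mult mult.assoc)
  finally have num: "?num \<le> c * ennreal (K * (?a * (2 / (\<beta> / sqrt d)) ^ card ?U))" .

  have "c * ennreal (K * (?b * (2 * h) ^ card ?U)) = (c * ennreal (K * ?b)) * ennreal ((2 * h) ^ card ?U)"
    using K0 h0 by (simp add: ennreal_mult mult.assoc)
  also have "ennreal ((2 * h) ^ card ?U) = (\<integral>\<^sup>+ \<theta>. (\<Prod>u\<in>?U. indicator {\<Omega>0 $$ u - h..\<Omega>0 $$ u + h} (\<theta> u)) \<partial>?P)"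
    unfolding param_space_def using h0 by (intro nn_integral_cube[symmetric] finite_free_idx) simp
  also have "(c * ennreal (K * ?b)) * \<dots>
    = (\<integral>\<^sup>+ \<theta>. (c * ennreal (K * ?b)) * (\<Prod>u\<in>?U. indicator {\<Omega>0 $$ u - h..\<Omega>0 $$ u + h} (\<theta> u)) \<partial>?P)"
    unfolding param_space_def
    by (rule nn_integral_cmult[symmetric], rule borel_measurable_prod_ennreal)
       (rule measurable_compose[OF measurable_lborel_component], simp_all)
  also have "\<dots> \<le> ?den"
  proof (rule nn_integral_mono)
    fix \<theta> :: "nat \<times> nat \<Rightarrow> real"
    show "(c * ennreal (K * ?b)) * (\<Prod>u\<in>?U. indicator {\<Omega>0 $$ u - h..\<Omega>0 $$ u + h} (\<theta> u))
      \<le> ennreal (likelihood n p (to_mat p E \<theta>) Y) * gw_density p E \<delta> \<Psi> \<theta>"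
    proof (cases "\<forall>u\<in>?U. \<theta> u \<in> {\<Omega>0 $$ u - h..\<Omega>0 $$ u + h}")
      case True
      then have "K * ?b \<le> Lg \<theta>" by (intro lower) (auto simp: abs_le_iff)
      then have "c * ennreal (K * ?b) \<le> c * ennreal (Lg \<theta>)" by (intro mult_left_mono ennreal_leI) auto
      moreover have "(\<Prod>u\<in>?U. indicator {\<Omega>0 $$ u - h..\<Omega>0 $$ u + h} (\<theta> u)) = (1::ennreal)"
        using True by (intro prod.neutral) auto
      ultimately show ?thesis unfolding dens by simp
    next
      case False
      then have "(\<Prod>u\<in>?U. indicator {\<Omega>0 $$ u - h..\<Omega>0 $$ u + h} (\<theta> u)) = (0::ennreal)"
        by (intro prod_zero[OF finite_free_idx]) (auto simp: indicator_def)
      then show ?thesis by (simp only: mult_zero_right zero_le)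
    qed
  qed
  finally have den: "c * ennreal (K * (?b * (2 * h) ^ card ?U)) \<le> ?den" .

  \<comment> \<open>The condition \<open>64 \<le> k\<^sup>2 * M\<close> gives
    \<open>\<beta> * \<epsilon> \<ge> 2 * d * l\<close>, hence each Laplace integral is at most the
    side \<open>2 * h\<close> of the cube. The third condition on \<open>M\<close> pays for the loss
    in the denominator, and its summand 1 leaves a surplus \<open>d * l\<close>, at least
    \<open>l\<close>, which becomes the factor \<open>exp (- l)\<close>.\<close>
  have key: "?a * (2 / (\<beta> / sqrt d)) ^ card ?U \<le> exp (- l) * (?b * (2 * h) ^ card ?U)"
  proof -
    have "\<beta> * \<epsilon> = k\<^sup>2 * M / 32 * (d * l)" unfolding \<epsilon>(2)[symmetric] by (simp add: \<beta>_def power2_eq_square)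
    moreover have "64 / 32 * (d * l) \<le> k\<^sup>2 * M / 32 * (d * l)"
      using M(2) d1 l by (intro mult_right_mono divide_right_mono) auto
    ultimately have b2: "2 * (d * l) \<le> \<beta> * \<epsilon>" by simp
    have "0 \<le> d * l" using d1 l by simp
    then have dl: "d * l \<le> \<beta> * \<epsilon>" using b2 by linarith
    have "(2 / k\<^sup>2 + C / 2 + 1) * (d * l) \<le> M * (d * l)" using M(3) d1 l by (intro mult_right_mono) auto
    also have "\<dots> \<le> M * (\<beta> * \<epsilon>)" using dl M0 by (intro mult_left_mono) auto
    finally have "(2 / k\<^sup>2 + C / 2) * (d * l) + d * l \<le> \<beta> * (M * \<epsilon>)" by (simp add: algebra_simps)
    moreover have "l \<le> d * l" using d1 l by simp
    ultimately have "- \<beta> * (M * \<epsilon>) \<le> - l + - (2 / k\<^sup>2 + C / 2) * (d * l)"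
      unfolding mult_minus_left by linarith
    then have "?a \<le> exp (- l + - (2 / k\<^sup>2 + C / 2) * (d * l))" unfolding exp_le_cancel_iff .
    then have 1: "?a \<le> exp (- l) * ?b" unfolding exp_add .
    have "2 * d \<le> 2 * (d * l)" using d1 l by simp
    then have "2 * d \<le> \<beta> * \<epsilon>" using b2 by linarith
    then have "2 * sqrt d * sqrt d \<le> \<beta> * \<epsilon>" using d1 by (simp add: mult.assoc)
    then have "2 * sqrt d / \<beta> \<le> \<epsilon> / sqrt d"
      using \<beta>0 d1 by (simp add: pos_divide_le_eq pos_le_divide_eq mult.commute)
    then have "2 / (\<beta> / sqrt d) \<le> 2 * h" by (simp add: h_def)
    then have 2: "(2 / (\<beta> / sqrt d)) ^ card ?U \<le> (2 * h) ^ card ?U" using \<beta>0 d1 by (intro power_mono) auto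
    have "?a * (2 / (\<beta> / sqrt d)) ^ card ?U \<le> (exp (- l) * ?b) * (2 * h) ^ card ?U"
      using 1 2 \<beta>0 d1 by (intro mult_mono) auto
    then show ?thesis by (simp add: mult.assoc)
  qed
  have "?num \<le> c * ennreal (K * (exp (- l) * (?b * (2 * h) ^ card ?U)))"
    using num by (rule order_trans) (use K0 key in \<open>intro mult_left_mono ennreal_leI; simp\<close>)
  also have "\<dots> = ennreal (exp (- l)) * (c * ennreal (K * (?b * (2 * h) ^ card ?U)))"
    using K0 h0 by (simp add: ennreal_mult mult_ac)
  also have "\<dots> \<le> ennreal (exp (- l)) * ?den" by (intro mult_left_mono den) simp
  finally have nd: "?num \<le> ennreal (exp (- l)) * ?den" .
  \<comment> \<open>In the degenerate cases the quotient is zero: a zero denominator forces a zero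
    numerator by \<open>nd\<close>, and an infinite denominator has inverse zero.\<close>
  have "?num / ?den \<le> ennreal (exp (- l))"
  proof (cases "?den = 0 \<or> ?den = \<infinity>")
    case True
    then show ?thesis using nd by (auto simp: divide_ennreal_def)
  next
    case False
    then have "?num / ?den \<le> ennreal (exp (- l)) * ?den / ?den" using nd by (intro divide_right_mono_ennreal)
    also have "\<dots> = ennreal (exp (- l))" using False by (intro ennreal_mult_divide_eq) auto
    finally show ?thesis .
  qed
  then show ?thesis unfolding posterior_def by (intro enn2real_leI) auto
qed

text \<open>Convergence in probability is expressed by measurable sets \<open>B n\<close> that cover
  the exceptional events and have vanishing probability. This form makes sense before measurability
  of the posterior as a function of the data is settled. \<open>M0\<close> is chosen before
  \<open>\<epsilon>\<close>.\<close>

theorem theorem4: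
  fixes p :: "nat \<Rightarrow> nat"
    and E :: "nat \<Rightarrow> nat \<Rightarrow> nat \<Rightarrow> bool"
    and \<Omega>0 :: "nat \<Rightarrow> real mat"
    and \<Psi> :: "nat \<Rightarrow> real mat"
    and k\<sigma> \<delta> a :: real
  assumes p_inf: "filterlim p at_top sequentially"
    and graph: "\<And>n. simple_graph (p n) (E n)"
    and decomp: "\<And>n. decomposable (p n) (E n)"
    and peo: "\<And>n. perfect_elim_order (p n) (E n)"
    and true_in_PG: "\<And>n. \<Omega>0 n \<in> P_G (p n) (E n)"
    and D_k: "0 < k\<sigma>" "k\<sigma> \<le> 1"
    and D_eig: "\<And>n ev. eigenvalue (\<Omega>0 n) ev \<Longrightarrow> k\<sigma> \<le> ev \<and> ev \<le> 1 / k\<sigma>"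
    and F: "(\<lambda>n. real (p n + num_edges (p n) (E n)) * ln (real (p n))) \<in> o(\<lambda>n. real n)"
    and \<delta>_pos: "0 < \<delta>"
    and \<Psi>_carrier: "\<And>n. \<Psi> n \<in> carrier_mat (p n) (p n)"
    and \<Psi>_pd: "\<And>n. pos_def (\<Psi> n)"
    and \<Psi>_eig: "\<And>n ev. eigenvalue (\<Psi> n) ev \<Longrightarrow> ev \<le> a"
  shows "\<exists>M0. \<forall>M \<ge> M0. \<forall>\<epsilon> > 0. \<exists>B.
           (\<forall>n. B n \<in> sets (sample_measure n (p n) (\<Omega>0 n)) \<and>
                {Y \<in> space (sample_measure n (p n) (\<Omega>0 n)).
                   \<epsilon> < posterior n (p n) (E n) \<delta> (\<Psi> n) Y
                     {\<theta> \<in> space (param_space (p n) (E n)).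
                        M * sqrt (real (p n + num_edges (p n) (E n)) * ln (real (p n)) / real n)
                          < frob_norm (to_mat (p n) (E n) \<theta> - \<Omega>0 n)}}
                \<subseteq> B n) \<and>
           (\<lambda>n. measure (sample_measure n (p n) (\<Omega>0 n)) (B n)) \<longlonglongrightarrow> 0"
proof -
  define d where "d n = real (p n + num_edges (p n) (E n))" for n
  define l where "l n = ln (real (p n))" for n
  define eps where "eps n = sqrt (d n * l n / real n)" for n
  \<comment> \<open>The three summands are the scatter deviation, the prior scale matrix, and the
    excess \<open>\<delta>\<close> in the exponent of the determinant.\<close>
  define C where "C = 1 + \<bar>a\<bar> + \<delta> / k\<sigma>"
  define M0 where "M0 = max (8 * C / k\<sigma>\<^sup>2) (max (64 / k\<sigma>\<^sup>2) (2 / k\<sigma>\<^sup>2 + C / 2 + 1))"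
  have k2: "k\<sigma>\<^sup>2 > 0" using D_k by simp
  have C0: "C \<ge> 0" using D_k \<delta>_pos by (simp add: C_def)
  have OM: "\<Omega>0 n \<in> M_G (p n) (E n)" and Opd: "pos_def (\<Omega>0 n)" for n
    using true_in_PG[of n] by (auto simp: P_G_def)
  note OC = M_G_carrier(1)[OF OM]
  have "\<exists>S. spectral_perturbation (p n) k\<sigma> (\<Omega>0 n) S" for n
    by (rule pos_def_perturbation[OF OC M_G_carrier(2)[OF OM] D_k(1) D_eig])
  then obtain S where S: "\<And>n. spectral_perturbation (p n) k\<sigma> (\<Omega>0 n) (S n)" by metis
  have S': "S n \<in> carrier_mat (p n) (p n)" "frob_sq (p n) (S n) \<le> real (p n) / k\<sigma>\<^sup>2" for n
    using S[of n] by (auto simp: spectral_perturbation_def)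
  have fPsi: "frob_sq (p n) (\<Psi> n) \<le> real (p n) * a\<^sup>2" for n
    by (rule pos_def_frob_sq_le[OF \<Psi>_carrier \<Psi>_pd \<Psi>_eig])
  have l_inf: "filterlim l at_top sequentially"
    unfolding l_def using p_inf
    by (intro filterlim_compose[OF ln_at_top] filterlim_compose[OF filterlim_real_sequentially])
  have eps_0: "eps \<longlonglongrightarrow> 0"
  proof -
    have "(\<lambda>n. d n * l n / real n) \<longlonglongrightarrow> 0"
      using smalloD_tendsto[OF F] by (simp add: d_def l_def)
    then show ?thesis unfolding eps_def using tendsto_real_sqrt by fastforce
  qed
  define dev where "dev n Y = (\<Sum>(i,j)\<in>{(i,j). i < p n \<and> j < p n \<and> (i = j \<or> E n i j)}.
      (scatter n Y i j - real n * S n $$ (i,j))\<^sup>2)" for n Y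
  have "\<exists>B. (\<forall>n. B n \<in> sets (sample_measure n (p n) (\<Omega>0 n)) \<and>
          {Y \<in> space (sample_measure n (p n) (\<Omega>0 n)).
             \<epsilon> < posterior n (p n) (E n) \<delta> (\<Psi> n) Y
               {\<theta> \<in> space (param_space (p n) (E n)). M * eps n < frob_norm (to_mat (p n) (E n) \<theta> - \<Omega>0 n)}}
          \<subseteq> B n) \<and>
       (\<lambda>n. measure (sample_measure n (p n) (\<Omega>0 n)) (B n)) \<longlonglongrightarrow> 0"
    if M: "M \<ge> M0" and \<epsilon>: "\<epsilon> > 0" for M \<epsilon> :: real
  proof -
    have M1: "8 * C \<le> k\<sigma>\<^sup>2 * M" "64 \<le> k\<sigma>\<^sup>2 * M" "2 / k\<sigma>\<^sup>2 + C / 2 + 1 \<le> M"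
      using M k2 by (auto simp: M0_def pos_divide_le_eq mult.commute)
    \<comment> \<open>\<open>3 \<le> p n\<close> ensures \<open>l n \<ge> 1\<close>, because
      \<open>exp 1\<close> is at most 3. The other clauses are the smallness conditions of the tail
      bound and the comparison with the given level \<open>\<epsilon>\<close>.\<close>
    define good where "good n \<longleftrightarrow> 0 < n \<and> \<delta> \<le> real n \<and> 3 \<le> p n \<and> k\<sigma> * (M * eps n) \<le> 1 \<and> exp (- l n) \<le> \<epsilon>" for n
    define dv where "dv n = {Y \<in> space (sample_measure n (p n) (\<Omega>0 n)). real n * (d n * l n) < dev n Y}" for n
    \<comment> \<open>For indices that are not good the whole space is a trivial cover. Only
      finitely many are affected, so the limit is unchanged.\<close>
    define B where "B n = (if good n then dv n else space (sample_measure n (p n) (\<Omega>0 n)))" for n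
    have l1: "l n \<ge> 1" and p0: "p n > 0" and d1: "d n \<ge> 1" if "good n" for n
    proof -
      have p3: "3 \<le> real (p n)" using that by (simp add: good_def)
      then have "exp 1 \<le> real (p n)" using exp_le by linarith
      then show "l n \<ge> 1" unfolding l_def using p3 by (subst ln_ge_iff) auto
      show "p n > 0" using p3 by simp
      show "d n \<ge> 1" using p3 by (simp add: d_def)
    qed
    have dvs: "dv n \<in> sets (sample_measure n (p n) (\<Omega>0 n))"
      "measure (sample_measure n (p n) (\<Omega>0 n)) (dv n) \<le> 384 / k\<sigma>\<^sup>2 / l n" if "good n" for n
    proof -
      have n: "n > 0" using that by (simp add: good_def)
      have "l n > 0" using l1[OF that] by simp
      note sd = scatter_deviation_prob[OF OC Opd graph S D_k(1) n this p0[OF that]]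
      show "dv n \<in> sets (sample_measure n (p n) (\<Omega>0 n))"
        unfolding dv_def dev_def d_def by (rule sd(1))
      show "measure (sample_measure n (p n) (\<Omega>0 n)) (dv n) \<le> 384 / k\<sigma>\<^sup>2 / l n"
        unfolding dv_def dev_def d_def by (rule sd(2))
    qed
    have post: "posterior n (p n) (E n) \<delta> (\<Psi> n) Y
        {\<theta> \<in> space (param_space (p n) (E n)). M * eps n < frob_norm (to_mat (p n) (E n) \<theta> - \<Omega>0 n)} \<le> \<epsilon>"
      if g: "good n" and Y: "dev n Y \<le> real n * (d n * l n)" for n Y
    proof -
      have n: "0 < n" "\<delta> \<le> real n" "k\<sigma> * (M * eps n) \<le> 1" using g by (auto simp: good_def)
      note l1 = l1[OF g] and d1 = d1[OF g] and p0 = p0[OF g]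
      have dl: "d n * l n \<ge> 1" using mult_mono[OF d1 l1] d1 by simp
      have e0: "eps n > 0" unfolding eps_def using n dl by simp
      have e2: "real n * (eps n)\<^sup>2 = d n * l n" unfolding eps_def using n dl by simp
      have "real (p n) * 1 * 1 \<le> d n * l n * real n" using n l1 d1 by (intro mult_mono) (auto simp: d_def)
      then have pt: "real (p n) \<le> real n * (d n * l n)" by (simp add: mult_ac)
      \<comment> \<open>This converts the noise level \<open>sqrt t\<close> of the score bound into
        the scale \<open>n * eps n\<close> of the tail bound.\<close>
      have "real n * (d n * l n) = (real n * eps n)\<^sup>2" unfolding e2[symmetric] by (simp add: power2_eq_square)
      then have st: "sqrt (real n * (d n * l n)) = real n * eps n" using n e0 by simp
      have "posterior n (p n) (E n) \<delta> (\<Psi> n) Y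
        {\<theta> \<in> space (param_space (p n) (E n)). M * eps n < frob_norm (to_mat (p n) (E n) \<theta> - \<Omega>0 n)} \<le> exp (- l n)"
      proof (rule posterior_tail_bound[OF graph true_in_PG \<Psi>_carrier S D_k(1) n(1) \<delta>_pos n(2) p0 d_def e0 e2 l1 _ C0 M1 n(3)])
        fix D assume D: "D \<in> M_G (p n) (E n)"
        show "\<bar>frob_inner (p n) (mat (p n) (p n) (\<lambda>(i,j). scatter n Y i j + \<Psi> n $$ (i,j))) D - (real n + \<delta>) * frob_inner (p n) (S n) D\<bar>
          \<le> C * (real n * eps n) * sqrt (frob_sq (p n) D)"
          using score_bound[OF D \<Psi>_carrier S' D_k(1) \<delta>_pos fPsi pt Y[unfolded dev_def]]
          unfolding st C_def .
      qed
      also have "\<dots> \<le> \<epsilon>" using g by (simp add: good_def)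
      finally show ?thesis .
    qed
    have M_pos: "M > 0" using M1(2) k2 by (metis less_le_trans zero_less_mult_pos zero_less_numeral)
    have ev: "eventually good sequentially"
    proof -
      have 1: "eventually (\<lambda>n. 0 < n) sequentially" by (rule eventually_gt_at_top)
      have 2: "eventually (\<lambda>n. \<delta> \<le> real n) sequentially"
        using filterlim_real_sequentially by (simp add: filterlim_at_top)
      have 3: "eventually (\<lambda>n. 3 \<le> p n) sequentially" using p_inf by (simp add: filterlim_at_top)
      have "eventually (\<lambda>n. eps n < 1 / (k\<sigma> * M)) sequentially"
        using eps_0 D_k M_pos by (intro order_tendstoD(2)) auto
      then have 4: "eventually (\<lambda>n. k\<sigma> * (M * eps n) \<le> 1) sequentially"
        by eventually_elim (use D_k M_pos in \<open>simp add: field_simps\<close>)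
      have "eventually (\<lambda>n. - ln \<epsilon> \<le> l n) sequentially" using l_inf by (simp add: filterlim_at_top)
      then have 5: "eventually (\<lambda>n. exp (- l n) \<le> \<epsilon>) sequentially"
      proof eventually_elim
        case (elim n)
        then have "exp (- l n) \<le> exp (ln \<epsilon>)" by simp
        then show ?case using \<epsilon> by simp
      qed
      show ?thesis unfolding good_def using 1 2 3 4 5 by eventually_elim auto
    qed
    have lim: "(\<lambda>n. 384 / k\<sigma>\<^sup>2 / l n) \<longlonglongrightarrow> 0"
      using l_inf by (intro tendsto_divide_0[OF tendsto_const] filterlim_at_top_imp_at_infinity)
    have le: "eventually (\<lambda>n. measure (sample_measure n (p n) (\<Omega>0 n)) (B n) \<le> 384 / k\<sigma>\<^sup>2 / l n) sequentially"
      using ev by eventually_elim (simp only: B_def if_True dvs(2))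
    have "(\<lambda>n. measure (sample_measure n (p n) (\<Omega>0 n)) (B n)) \<longlonglongrightarrow> 0"
      by (rule tendsto_sandwich[OF _ le tendsto_const lim]) simp
    moreover have "B n \<in> sets (sample_measure n (p n) (\<Omega>0 n)) \<and>
          {Y \<in> space (sample_measure n (p n) (\<Omega>0 n)).
             \<epsilon> < posterior n (p n) (E n) \<delta> (\<Psi> n) Y
               {\<theta> \<in> space (param_space (p n) (E n)). M * eps n < frob_norm (to_mat (p n) (E n) \<theta> - \<Omega>0 n)}}
          \<subseteq> B n" for n
    proof (cases "good n")
      case True
      then show ?thesis using dvs(1)[OF True] post[OF True] by (force simp: B_def dv_def not_less[symmetric])
    qed (auto simp: B_def)
    ultimately show ?thesis by blast
  qed
  then show ?thesis unfolding eps_def d_def l_def by blast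
qed

end
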